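(* Let $\lambda_0\in\mathbb{R}$ and let $g$ be any exchangeable prior distribution of $\tau_0$. A pseudo symmetric approximate design $d$ is ${\cal E}_{g,\lambda_0}$-optimal if and only if $q_d(x_d)>0$ and $$\max_{s\in{\cal S}}\frac{q_s(x_d)}{q_d(x_d)}=1.$$ Moreover, in that case every sequence $s$ in the design $d$ (i.e. with $p_s>0$) attains this maximum.
   Context: Fix integers $p\ge2$ (periods), $t\ge2$ (treatments), $n\ge1$ (subjects) and a symmetric positive definite real $p\times p$ matrix $\Sigma$ (within-subject covariance). $1_k$ is the all-ones vector of length $k$, $J_k=1_k1_k'$, $B_k=I_k-J_k/k$, prime denotes transpose, and $\tilde B=\Sigma^{-1}-\Sigma^{-1}J_p\Sigma^{-1}/(1_p'\Sigma^{-1}1_p)$. Let ${\cal S}=\{1,\dots,t\}^p$ be the set of treatment sequences. For $s=(t_1,\dots,t_p)\in{\cal S}$, $T_s$ is the $p\times t$ matrix with $(k,i)$ entry $1$ if $t_k=i$ and $0$ otherwise; $F_s$ is the $p\times t$ matrix with zero first row and, for $k\ge2$, $(k,i)$ entry $1$ if $t_{k-1}=i$ and $0$ otherwise. An (approximate) design $d$ is a vector $P_d=(p_s)_{s\in{\cal S}}$ with $p_s\ge0$, $\sum_sp_s=1$. For $1\le i,j\le2$ put $\hat C_{sij}=B_tG_{s,i}'\tilde BG_{s,j}B_t$ with $G_{s,1}=T_s$, $G_{s,2}=F_s$, $\hat C_{dij}=n\sum_sp_s\hat C_{sij}$, $C_{dij}=\hat C_{dij}-nG_i'\tilde BG_j$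 with $G_1=\sum_sp_sT_sB_t$, $G_2=\sum_sp_sF_sB_t$; $c_{sij}=\mathrm{tr}(\hat C_{sij})$, $c_{dij}=n\sum_sp_sc_{sij}$; $q_s(x)=c_{s11}+2c_{s12}x+c_{s22}x^2$, $q_d(x)=\sum_sp_sq_s(x)$, $x_d=-c_{d12}/c_{d22}$. A design $d$ is pseudo symmetric if all treatments are equally replicated in each period (for all $k,i$: the sum of $p_s$ over sequences $s$ with $t_k=i$ is $1/t$) and the matrices $C_{dij}$, $1\le i,j\le2$, are completely symmetric (of the form $aI_t+bJ_t$). In the proportional model (carryover effects equal $\lambda$ times direct effects $\tau$), Fisher's information matrix for $\tau$ at $(\tau_0,\lambda_0)$ is $C_{d,\tau_0,\lambda_0}(\tau)=C_{d11}+\lambda_0(C_{d12}+C_{d21})+\lambda_0^2C_{d22}-(C_{d12}+\lambda_0C_{d22})\tau_0(\tau_0'C_{d22}\tau_0)^{-1}\tau_0'(C_{d21}+\lambda_0C_{d22})$, the last term being $0$ if $\tau_0'C_{d22}\tau_0=0$. The prior $g$ is a probability distribution on $\{\tau_0\in\mathbb{R}^t:1_t'\tau_0=0,\ \tau_0\ne0\}$; it is exchangeable if invariant under all permutations of coordinates. ${\cal E}_{g,\lambda_0}(d)=\mathbb{E}_g[\Phi_E(C_{d,\tau_0,\lambda_0}(\tau))]$, where $\Phi_E$ is the second smallest eigenvalue (counted with multiplicity), and a design is ${\cal E}_{g,\lambda_0}$-optimal if it maximizes this over all approximate designs. *)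

theory Defs
  imports "HOL-Probability.Probability"
begin

text \<open>
  Periods are indexed by a finite linearly ordered type \<open>'p\<close> (\<open>CARD('p)\<close> periods), treatments by a
  finite type \<open>'t\<close> (\<open>CARD('t)\<close> treatments). A treatment sequence is a function \<open>s :: 'p \<Rightarrow> 't\<close>,
  and an approximate design is a weight function on all sequences.
\<close>

type_synonym 'n sqmat = "real^'n^'n"
type_synonym ('p, 't) mat = "real^'t^'p"
type_synonym ('p, 't) design = "('p \<Rightarrow> 't) \<Rightarrow> real"

definition sym_pos_def :: "real^'n^'n \<Rightarrow> bool" where
  "sym_pos_def A \<longleftrightarrow> transpose A = A \<and> (\<forall>x. x \<noteq> 0 \<longrightarrow> x \<bullet> (A *v x) > 0)"

definition ones_mat :: "real^'n^'n" where
  "ones_mat = (\<chi> i j. 1)"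

definition centering :: "real^'n^'n" where
  "centering = mat 1 - (1 / real CARD('n)) *\<^sub>R ones_mat"

definition B_tilde :: "('p::finite) sqmat \<Rightarrow> 'p sqmat" where
  "B_tilde \<Sigma> = matrix_inv \<Sigma> - (1 / ((\<chi> k. 1) \<bullet> (matrix_inv \<Sigma> *v (\<chi> k. 1)))) *\<^sub>R
     (matrix_inv \<Sigma> ** ones_mat ** matrix_inv \<Sigma>)"

definition T_mat :: "('p::finite \<Rightarrow> 't::finite) \<Rightarrow> ('p, 't) mat" where
  "T_mat s = (\<chi> k i. if s k = i then 1 else 0)"

text \<open>In a period \<open>k\<close> that is not the first one, \<open>Max {..<k}\<close> is the preceding period.\<close>

definition F_mat :: "('p::{finite,linorder} \<Rightarrow> 't::finite) \<Rightarrow> ('p, 't) mat" where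
  "F_mat s = (\<chi> k i. if {..<k} \<noteq> {} \<and> s (Max {..<k}) = i then 1 else 0)"

text \<open>\<open>Direct\<close> and \<open>Carryover\<close> play the role of the indices 1 and 2 of \<open>G\<^sub>s\<^sub>,\<^sub>i\<close>, \<open>C\<^sub>d\<^sub>i\<^sub>j\<close>, \<open>c\<^sub>d\<^sub>i\<^sub>j\<close>.\<close>

datatype effect = Direct | Carryover

fun G_seq :: "effect \<Rightarrow> ('p::{finite,linorder} \<Rightarrow> 't::finite) \<Rightarrow> ('p, 't) mat" where
  "G_seq Direct s = T_mat s"
| "G_seq Carryover s = F_mat s"

definition C_hat_seq ::
  "'p sqmat \<Rightarrow> ('p::{finite,linorder} \<Rightarrow> 't::finite) \<Rightarrow> effect \<Rightarrow> effect \<Rightarrow> 't sqmat" where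
  "C_hat_seq \<Sigma> s i j =
     centering ** transpose (G_seq i s) ** B_tilde \<Sigma> ** G_seq j s ** centering"

definition c_seq ::
  "'p sqmat \<Rightarrow> ('p::{finite,linorder} \<Rightarrow> 't::finite) \<Rightarrow> effect \<Rightarrow> effect \<Rightarrow> real" where
  "c_seq \<Sigma> s i j = trace (C_hat_seq \<Sigma> s i j)"

definition approx_design :: "('p::finite, 't::finite) design \<Rightarrow> bool" where
  "approx_design P \<longleftrightarrow> (\<forall>s. P s \<ge> 0) \<and> (\<Sum>s\<in>UNIV. P s) = 1"

definition C_hat_des ::
  "nat \<Rightarrow> 'p sqmat \<Rightarrow> ('p::{finite,linorder}, 't::finite) design \<Rightarrow> effect \<Rightarrow> effect \<Rightarrow> 't sqmat"
  where
  "C_hat_des n \<Sigma> P i j = real n *\<^sub>R (\<Sum>s\<in>UNIV. P s *\<^sub>R C_hat_seq \<Sigma> s i j)"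

definition G_des ::
  "('p::{finite,linorder}, 't::finite) design \<Rightarrow> effect \<Rightarrow> ('p, 't) mat" where
  "G_des P i = (\<Sum>s\<in>UNIV. P s *\<^sub>R (G_seq i s ** centering))"

definition C_des ::
  "nat \<Rightarrow> 'p sqmat \<Rightarrow> ('p::{finite,linorder}, 't::finite) design \<Rightarrow> effect \<Rightarrow> effect \<Rightarrow> 't sqmat"
  where
  "C_des n \<Sigma> P i j =
     C_hat_des n \<Sigma> P i j - real n *\<^sub>R (transpose (G_des P i) ** B_tilde \<Sigma> ** G_des P j)"

definition c_des ::
  "nat \<Rightarrow> 'p sqmat \<Rightarrow> ('p::{finite,linorder}, 't::finite) design \<Rightarrow> effect \<Rightarrow> effect \<Rightarrow> real"
  where
  "c_des n \<Sigma> P i j = real n * (\<Sum>s\<in>UNIV. P s * c_seq \<Sigma> s i j)"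

definition q_seq ::
  "'p sqmat \<Rightarrow> ('p::{finite,linorder} \<Rightarrow> 't::finite) \<Rightarrow> real \<Rightarrow> real" where
  "q_seq \<Sigma> s x = c_seq \<Sigma> s Direct Direct + 2 * c_seq \<Sigma> s Direct Carryover * x
     + c_seq \<Sigma> s Carryover Carryover * x^2"

definition q_des ::
  "'p sqmat \<Rightarrow> ('p::{finite,linorder}, 't::finite) design \<Rightarrow> real \<Rightarrow> real" where
  "q_des \<Sigma> P x = (\<Sum>s\<in>UNIV. P s * q_seq \<Sigma> s x)"

definition x_des ::
  "nat \<Rightarrow> 'p sqmat \<Rightarrow> ('p::{finite,linorder}, 't::finite) design \<Rightarrow> real" where
  "x_des n \<Sigma> P = - c_des n \<Sigma> P Direct Carryover / c_des n \<Sigma> P Carryover Carryover"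

definition completely_symmetric :: "real^'n^'n \<Rightarrow> bool" where
  "completely_symmetric A \<longleftrightarrow> (\<exists>a b. A = a *\<^sub>R mat 1 + b *\<^sub>R ones_mat)"

definition pseudo_symmetric ::
  "nat \<Rightarrow> 'p sqmat \<Rightarrow> ('p::{finite,linorder}, 't::finite) design \<Rightarrow> bool" where
  "pseudo_symmetric n \<Sigma> P \<longleftrightarrow>
     (\<forall>k i. (\<Sum>s | s k = i. P s) = 1 / real CARD('t)) \<and>
     (\<forall>i j. completely_symmetric (C_des n \<Sigma> P i j))"

definition info_mat ::
  "nat \<Rightarrow> 'p sqmat \<Rightarrow> ('p::{finite,linorder}, 't::finite) design \<Rightarrow> real^'t \<Rightarrow> real \<Rightarrow> 't sqmat"
  where
  "info_mat n \<Sigma> P \<tau> lam =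
    (let C = C_des n \<Sigma> P; C22 = C Carryover Carryover; r = \<tau> \<bullet> (C22 *v \<tau>) in
      C Direct Direct + lam *\<^sub>R (C Direct Carryover + C Carryover Direct) + lam^2 *\<^sub>R C22
      - (if r = 0 then 0
         else (1 / r) *\<^sub>R ((C Direct Carryover + lam *\<^sub>R C22) **
                (\<chi> i j. \<tau> $ i * \<tau> $ j) ** (C Carryover Direct + lam *\<^sub>R C22))))"

text \<open>
  The real eigenvalues with multiplicity. The multiplicity is the dimension of the eigenspace; this is
  used only for symmetric matrices, where it agrees with the multiplicity as a root of the
  characteristic polynomial.
\<close>

definition eigenspace :: "real^'n^'n \<Rightarrow> real \<Rightarrow> (real^'n) set" where
  "eigenspace A l = {v. A *v v = l *\<^sub>R v}"

definition eigenvalue_mset :: "real^'n^'n \<Rightarrow> real multiset" where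
  "eigenvalue_mset A =
     (\<Sum>l | \<exists>v. v \<noteq> 0 \<and> v \<in> eigenspace A l. replicate_mset (dim (eigenspace A l)) l)"

definition second_smallest_eigenvalue :: "real^'n^'n \<Rightarrow> real" where
  "second_smallest_eigenvalue A = sorted_list_of_multiset (eigenvalue_mset A) ! 1"

definition treatment_prior :: "(real^'t) measure \<Rightarrow> bool" where
  "treatment_prior g \<longleftrightarrow> prob_space g \<and> sets g = sets borel \<and>
     (AE \<tau> in g. (\<Sum>i\<in>UNIV. \<tau> $ i) = 0 \<and> \<tau> \<noteq> 0)"

definition exchangeable :: "(real^'t) measure \<Rightarrow> bool" where
  "exchangeable g \<longleftrightarrow> (\<forall>\<pi>. bij \<pi> \<longrightarrow> distr g borel (\<lambda>\<tau>. \<chi> i. \<tau> $ \<pi> i) = g)"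

text \<open>
  The integrand below is a bounded Borel function of \<open>\<tau>\<close>, so that the Bochner integral is the
  expectation and not its default value.
\<close>

definition E_crit ::
  "(real^'t) measure \<Rightarrow> real \<Rightarrow> nat \<Rightarrow> 'p sqmat \<Rightarrow>
    ('p::{finite,linorder}, 't::finite) design \<Rightarrow> real" where
  "E_crit g lam n \<Sigma> P = (LINT \<tau>|g. second_smallest_eigenvalue (info_mat n \<Sigma> P \<tau> lam))"

definition E_optimal ::
  "(real^'t) measure \<Rightarrow> real \<Rightarrow> nat \<Rightarrow> 'p sqmat \<Rightarrow>
    ('p::{finite,linorder}, 't::finite) design \<Rightarrow> bool" where
  "E_optimal g lam n \<Sigma> P \<longleftrightarrow>
     approx_design P \<and> (\<forall>P'. approx_design P' \<longrightarrow> E_crit g lam n \<Sigma> P' \<le> E_crit g lam n \<Sigma> P)"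

end

theory Submission
  imports Defs
begin

text \<open>
  The information matrix kills the all-ones vector, so its second smallest eigenvalue is at most its
  Rayleigh quotient at \<open>\<tau>\<^sub>0\<close>. There the subtracted term is a partial minimisation of
  a joint quadratic form in direct and carryover effects, whence the bound
  \<open>\<tau>\<^sub>0' H(x) \<tau>\<^sub>0 / \<tau>\<^sub>0' \<tau>\<^sub>0\<close> for every real \<open>x\<close>, where
  \<open>H(x)\<close> has trace \<open>n q\<^sub>d(x)\<close>. For an exchangeable prior the expectation of
  \<open>\<tau>\<^sub>0 \<tau>\<^sub>0' / \<tau>\<^sub>0' \<tau>\<^sub>0\<close> is \<open>B\<^sub>t / (t - 1)\<close>, so the criterion is at most
  \<open>n q\<^sub>d(x) / (t - 1)\<close>, and for pseudo symmetric designs it equals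
  \<open>n q\<^sub>d(x\<^sub>d) / (t - 1) = n min\<^sub>x q\<^sub>d(x) / (t - 1)\<close>. This gives sufficiency.
  Conversely, if \<open>q\<^sub>s(x\<^sub>d) > q\<^sub>d(x\<^sub>d)\<close> for some \<open>s\<close>, mixing a little of the uniform
  distribution on the relabellings of \<open>s\<close> into \<open>d\<close> preserves symmetry and increases the minimum
  of the parabola \<open>q\<^sub>d\<close>, because its minimiser is unique.
\<close>

section \<open>The second smallest eigenvalue\<close>

text \<open>The value at the vertex \<open>- b / c\<close> gives the bound; for \<open>c = 0\<close>
  a nonnegative affine function is constant, so \<open>b = 0\<close>.\<close>

lemma quadratic_discriminant_le:
  fixes a b c :: real
  assumes nonneg: "\<And>y. 0 \<le> a + 2 * b * y + c * y\<^sup>2" and c: "0 \<le> c"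
  shows "b\<^sup>2 \<le> a * c"
proof (cases "c = 0")
  case True
  have "b = 0"
  proof (rule ccontr)
    assume "b \<noteq> 0"
    \<comment> \<open>At this argument the affine function equals -1.\<close>
    then show False
      using nonneg[of "- (a + 1) / (2 * b)"] True by (simp add: field_simps)
  qed
  then show ?thesis using True by simp
next
  case False
  then have "0 < c" using c by simp
  moreover have "a + 2 * b * (- b / c) + c * (- b / c)\<^sup>2 = a - b\<^sup>2 / c"
    using False by (simp add: field_simps power2_eq_square)
  ultimately have "0 \<le> (a - b\<^sup>2 / c) * c"
    using nonneg[of "- b / c"] by (metis less_imp_le mult_nonneg_nonneg)
  then show ?thesis using False by (simp add: left_diff_distrib)
qed

text \<open>Later used to raise the minimum of a parabola: one with minimum 0 at 0 is mixed with one
  that is positive at 0, and a single small weight \<epsilon> works for every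
  \<open>y\<close>.\<close>

lemma quadratic_perturbation:
  fixes a b c :: real
  assumes "0 < a" "0 < d"
  obtains \<epsilon> where "0 < \<epsilon>" "\<epsilon> \<le> 1"
    "\<And>y. c \<ge> 0 \<Longrightarrow> 0 < (1 - \<epsilon>) * (a * y\<^sup>2) + \<epsilon> * (d + b * y + c * y\<^sup>2)"
proof -
  \<comment> \<open>As \<epsilon> is at most 1/2, half of \<open>a * y^2\<close> survives, and it is
    enough that \<open>a * y^2 + 2 * \<epsilon> * (b * y + d)\<close> has negative discriminant,
    that is, \<open>\<epsilon> * b^2 < 2 * a * d\<close>.\<close>
  define \<epsilon> where "\<epsilon> = a * d / (2 * a * d + b\<^sup>2)"
  have pos: "0 < 2 * a * d + b\<^sup>2" using assms by (simp add: add_pos_nonneg)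
  then have \<epsilon>: "0 < \<epsilon>" "\<epsilon> \<le> 1 / 2" "\<epsilon> * b\<^sup>2 \<le> a * d"
    using assms by (simp_all add: \<epsilon>_def field_simps)
  have "0 < (1 - \<epsilon>) * (a * y\<^sup>2) + \<epsilon> * (d + b * y + c * y\<^sup>2)" if "c \<ge> 0" for y
  proof -
    have "0 \<le> (a * y + \<epsilon> * b)\<^sup>2" by simp
    then have "0 \<le> a * (a * y\<^sup>2 + 2 * \<epsilon> * b * y) + \<epsilon> * (\<epsilon> * b\<^sup>2)"
      by (simp add: power2_eq_square algebra_simps)
    also have "\<dots> \<le> a * (a * y\<^sup>2 + 2 * \<epsilon> * b * y) + \<epsilon> * (a * d)"
      using \<epsilon> by simp
    also have "\<dots> < a * (a * y\<^sup>2 + 2 * \<epsilon> * b * y) + 2 * (\<epsilon> * (a * d))"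
      using \<epsilon>(1) assms by simp
    also have "\<dots> = a * (a * y\<^sup>2 + 2 * \<epsilon> * (b * y + d))"
      by (simp add: algebra_simps)
    finally have "0 < a * y\<^sup>2 + 2 * \<epsilon> * (b * y + d)"
      using assms(1) by (simp add: zero_less_mult_iff)
    moreover have "\<epsilon> * (a * y\<^sup>2) \<le> (1 / 2) * (a * y\<^sup>2)"
      using \<epsilon>(2) assms(1) by (intro mult_right_mono) auto
    moreover have "0 \<le> \<epsilon> * (c * y\<^sup>2)" using \<epsilon>(1) that by simp
    ultimately show ?thesis by (simp add: algebra_simps)
  qed
  then show thesis using that[of \<epsilon>] \<epsilon> by simp
qed

section \<open>Eigenvectors of symmetric matrices\<close>

lemma inner_transpose_vector:
  fixes A :: "real^'n^'m"
  shows "x \<bullet> (transpose A *v y) = (A *v x) \<bullet> y"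
  by (simp add: dot_lmul_matrix flip: vector_transpose_matrix)

lemma symmetric_matrix_inner:
  fixes A :: "real^'n^'n"
  assumes "transpose A = A"
  shows "x \<bullet> (A *v y) = y \<bullet> (A *v x)"
  using inner_transpose_vector[of x A y] unfolding assms by (simp add: inner_commute)

text \<open>By compactness the Rayleigh quotient has a minimiser \<open>v\<close> on the unit sphere
  of \<open>S\<close>. Its residual \<open>w = A v - l v\<close> lies in \<open>S\<close> by
  invariance, and variation along \<open>w\<close> forces \<open>w = 0\<close>.\<close>

lemma symmetric_restricted_eigenvector:
  fixes A :: "real^'n^'n"
  assumes sym: "transpose A = A" and S: "subspace S" and inv: "\<And>x. x \<in> S \<Longrightarrow> A *v x \<in> S"
    and z: "z \<in> S" "z \<noteq> 0"
  obtains v l where "v \<in> S" "v \<noteq> 0" "A *v v = l *\<^sub>R v"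
    "\<And>x. x \<in> S \<Longrightarrow> l * (x \<bullet> x) \<le> x \<bullet> (A *v x)"
proof -
  let ?K = "S \<inter> sphere 0 1"
  have "compact ?K"
    using closed_subspace[OF S] by (simp add: closed_Int_compact)
  moreover have "z /\<^sub>R norm z \<in> ?K"
    using z S by (simp add: subspace_scale)
  moreover have "continuous_on ?K (\<lambda>x. x \<bullet> (A *v x))"
    by (intro continuous_intros linear_continuous_on matrix_vector_mul_bounded_linear)
  ultimately obtain v where v: "v \<in> ?K" and min: "\<And>y. y \<in> ?K \<Longrightarrow> v \<bullet> (A *v v) \<le> y \<bullet> (A *v y)"
    using continuous_attains_inf[of ?K "\<lambda>x. x \<bullet> (A *v x)"] by blast
  define l where "l = v \<bullet> (A *v v)"
  have vv: "v \<bullet> v = 1" using v by (simp add: dot_square_norm)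
  have ge: "l * (x \<bullet> x) \<le> x \<bullet> (A *v x)" if "x \<in> S" for x
  proof (cases "x = 0")
    case False
    have "x /\<^sub>R norm x \<in> ?K" using that S False by (simp add: subspace_scale)
    from min[OF this] False show ?thesis
      by (simp add: l_def matrix_vector_mult_scaleR dot_square_norm power2_eq_square field_simps)
  qed simp
  define w where "w = A *v v - l *\<^sub>R v"
  have wS: "w \<in> S" using v inv S by (simp add: w_def subspace_diff subspace_scale)
  have symi: "v \<bullet> (A *v w) = w \<bullet> (A *v v)"
    using inner_transpose_vector[of v A w] sym by (simp add: inner_commute)
  \<comment> \<open>Along \<open>v + y w\<close> the form of \<open>A - l\<close> is nonnegative,
    with constant term 0 and linear coefficient \<open>2 * (w \<bullet> w)\<close>, so the
    discriminant bound kills the latter.\<close>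
  have "(w \<bullet> w)\<^sup>2 \<le> 0 * (w \<bullet> (A *v w) - l * (w \<bullet> w))"
  proof (rule quadratic_discriminant_le)
    fix y :: real
    have "v + y *\<^sub>R w \<in> S" using v wS S by (simp add: subspace_add subspace_scale)
    from ge[OF this]
    have "0 \<le> (v + y *\<^sub>R w) \<bullet> (A *v (v + y *\<^sub>R w)) - l * ((v + y *\<^sub>R w) \<bullet> (v + y *\<^sub>R w))"
      by simp
    also have "\<dots> = 2 * y * (w \<bullet> (A *v v) - l * (w \<bullet> v)) + y\<^sup>2 * (w \<bullet> (A *v w) - l * (w \<bullet> w))"
      using vv symi by (simp add: matrix_vector_right_distrib matrix_vector_mult_scaleR inner_add_left
          inner_add_right l_def[symmetric] inner_commute[of v w] power2_eq_square algebra_simps)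
    also have "w \<bullet> (A *v v) - l * (w \<bullet> v) = w \<bullet> w"
      by (simp add: w_def inner_diff_right)
    finally show "0 \<le> 0 + 2 * (w \<bullet> w) * y + (w \<bullet> (A *v w) - l * (w \<bullet> w)) * y\<^sup>2"
      by (simp add: algebra_simps)
  qed (use ge[OF wS] in simp)
  then have "w = 0" by simp
  then show thesis
    using that[of v l] v vv ge by (force simp: w_def)
qed

lemma eigenvectors_orthogonal:
  fixes A :: "real^'n^'n"
  assumes "transpose A = A" "v \<in> eigenspace A l" "w \<in> eigenspace A m" "l \<noteq> m"
  shows "v \<bullet> w = 0"
proof -
  have "m * (v \<bullet> w) = l * (v \<bullet> w)"
    using inner_transpose_vector[of v A w] assms(1-3) by (simp add: eigenspace_def)
  then show ?thesis using assms(4) by simp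
qed

text \<open>Eigenvectors to distinct eigenvalues are orthogonal, so choosing one for each gives an
  independent set. Finiteness matters because the sum in \<open>eigenvalue_mset\<close> would
  default to the empty multiset over an infinite index set.\<close>

lemma finite_eigenvalues:
  fixes A :: "real^'n^'n"
  assumes sym: "transpose A = A"
  shows "finite {l. \<exists>v. v \<noteq> 0 \<and> v \<in> eigenspace A l}" (is "finite ?E")
proof -
  obtain f where "\<forall>l\<in>?E. f l \<noteq> 0 \<and> f l \<in> eigenspace A l"
    using bchoice[of ?E "\<lambda>l v. v \<noteq> 0 \<and> v \<in> eigenspace A l"] by blast
  then have f: "\<And>l. l \<in> ?E \<Longrightarrow> f l \<noteq> 0 \<and> f l \<in> eigenspace A l" by blast
  have orth: "f l \<bullet> f m = 0" if "l \<in> ?E" "m \<in> ?E" "l \<noteq> m" for l m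
    using eigenvectors_orthogonal[OF sym] f that by blast
  have "pairwise orthogonal (f ` ?E)"
    using orth by (auto simp: pairwise_def orthogonal_def)
  moreover have "0 \<notin> f ` ?E"
  proof
    assume "0 \<in> f ` ?E"
    then obtain l where l: "0 = f l" "l \<in> ?E" by (rule imageE)
    show False using f[OF l(2)] l(1) by simp
  qed
  ultimately have "finite (f ` ?E)"
    by (intro independent_imp_finite pairwise_orthogonal_independent)
  moreover have "inj_on f ?E"
  proof (rule inj_onI, rule ccontr)
    fix l m assume lm: "l \<in> ?E" "m \<in> ?E" "f l = f m" "l \<noteq> m"
    then have "f l \<bullet> f l = 0" using orth[OF lm(1,2,4)] by simp
    then show False using f[OF lm(1)] by simp
  qed
  ultimately show ?thesis by (simp add: finite_image_iff)
qed

lemma count_eigenvalue_mset: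
  fixes A :: "real^'n^'n"
  assumes "transpose A = A"
  shows "count (eigenvalue_mset A) l = dim (eigenspace A l)"
proof -
  let ?E = "{l. \<exists>v. v \<noteq> 0 \<and> v \<in> eigenspace A l}"
  have "count (eigenvalue_mset A) l = (\<Sum>k\<in>?E. if k = l then dim (eigenspace A k) else 0)"
    unfolding eigenvalue_mset_def count_sum by (intro sum.cong) auto
  also have "\<dots> = (if l \<in> ?E then dim (eigenspace A l) else 0)"
    using finite_eigenvalues[OF assms] by simp
  also have "\<dots> = dim (eigenspace A l)"
    by (auto simp: dim_eq_0)
  finally show ?thesis .
qed

section \<open>Second entry of a sorted multiset\<close>

lemma sorted_list_of_multiset_second:
  fixes N :: "'a::linorder multiset"
  assumes "size N \<ge> 2"
  obtains x y zs where "sorted_list_of_multiset N = x # y # zs" "N = mset (x # y # zs)"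
    "x \<le> y" "\<And>z. z \<in> set zs \<Longrightarrow> y \<le> z"
proof -
  have N: "mset (sorted_list_of_multiset N) = N" by simp
  have s: "sorted (sorted_list_of_multiset N)" by simp
  have "length (sorted_list_of_multiset N) \<ge> 2" using assms N by (metis size_mset)
  then obtain x y zs where xs: "sorted_list_of_multiset N = x # y # zs"
    by (auto simp: numeral_2_eq_2 Suc_le_length_iff)
  then show thesis using that[OF xs] s N by auto
qed

text \<open>Otherwise at most the first entry of the list would be bounded by \<open>c\<close>,
  whereas \<open>a\<close> and \<open>b\<close> are two such entries counted with
  multiplicity.\<close>

lemma second_sorted_le:
  fixes a b c :: "'a::linorder"
  assumes sub: "{#a, b#} \<subseteq># N" and "a \<le> c" "b \<le> c"
  shows "sorted_list_of_multiset N ! 1 \<le> c"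
proof -
  have two: "2 \<le> size (filter_mset (\<lambda>x. x \<le> c) N)"
    using size_mset_mono[OF multiset_filter_mono[OF sub, of "\<lambda>x. x \<le> c"]] assms by simp
  then have "2 \<le> size N" by (meson order_trans size_filter_mset_lesseq)
  then obtain x y zs where xs: "sorted_list_of_multiset N = x # y # zs" "N = mset (x # y # zs)"
    and o: "\<And>z. z \<in> set zs \<Longrightarrow> y \<le> z" by (rule sorted_list_of_multiset_second) blast
  have "y \<le> c"
  proof (rule ccontr)
    assume "\<not> y \<le> c"
    then have "filter_mset (\<lambda>x. x \<le> c) (mset (y # zs)) = {#}"
      using o by (auto simp flip: mset_filter simp: filter_empty_conv dest: order_trans)
    then have "size (filter_mset (\<lambda>x. x \<le> c) N) \<le> 1" unfolding xs(2) by simp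
    then show False using two by simp
  qed
  then show ?thesis using xs by simp
qed

text \<open>If the second entry were below \<open>c\<close>, so would be the first, and the filtered
  multiset would have two elements.\<close>

lemma second_sorted_ge:
  fixes a c :: "'a::linorder"
  assumes "size N \<ge> 2" and sub: "filter_mset (\<lambda>x. x < c) N \<subseteq># {#a#}"
  shows "c \<le> sorted_list_of_multiset N ! 1"
proof -
  obtain x y zs where xs: "sorted_list_of_multiset N = x # y # zs" "N = mset (x # y # zs)" "x \<le> y"
    using sorted_list_of_multiset_second[OF assms(1)] by metis
  have "size (filter_mset (\<lambda>x. x < c) N) \<le> 1" using size_mset_mono[OF sub] by simp
  then have "c \<le> y" using xs(3) unfolding xs(2) by (auto split: if_splits)
  then show ?thesis using xs by simp
qed

section \<open>Rayleigh bounds in the presence of a kernel vector\<close>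

text \<open>The orthogonal complement of \<open>u\<close> is invariant, and \<open>z\<close> shows
  that it is nontrivial. Its minimal eigenvalue \<open>l\<close> joins the eigenvalue 0 of
  \<open>u\<close>, which exhibits two elements of the spectrum.\<close>

lemma symmetric_kernel_eigenvalues:
  fixes A :: "real^'n^'n"
  assumes sym: "transpose A = A" and ker: "A *v u = 0" "u \<noteq> 0" and z: "z \<bullet> u = 0" "z \<noteq> 0"
  obtains v l where "v \<noteq> 0" "v \<bullet> u = 0" "A *v v = l *\<^sub>R v" "{#0, l#} \<subseteq># eigenvalue_mset A"
    "\<And>x. x \<bullet> u = 0 \<Longrightarrow> l * (x \<bullet> x) \<le> x \<bullet> (A *v x)"
proof -
  have "subspace {x. x \<bullet> u = 0}"
    by (simp add: subspace_def inner_add_left)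
  moreover have "(A *v x) \<bullet> u = 0" for x
    using inner_transpose_vector[of x A u] sym ker by simp
  ultimately obtain v l where v: "v \<bullet> u = 0" "v \<noteq> 0" "A *v v = l *\<^sub>R v"
    and min: "\<And>x. x \<bullet> u = 0 \<Longrightarrow> l * (x \<bullet> x) \<le> x \<bullet> (A *v x)"
    using symmetric_restricted_eigenvector[OF sym, of "{x. x \<bullet> u = 0}" z] z by auto
  have u0: "u \<in> eigenspace A 0" and vl: "v \<in> eigenspace A l"
    using ker v by (auto simp: eigenspace_def)
  have sub1: "1 \<le> dim (eigenspace A k)" if "w \<in> eigenspace A k" "w \<noteq> 0" for w k
    using that dim_eq_0[of "eigenspace A k"] by (cases "dim (eigenspace A k)") auto
  have uv: "u \<noteq> v" using v(1,2) by (metis inner_eq_zero_iff)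
  have "independent {u, v}"
    using v uv ker by (intro pairwise_orthogonal_independent)
      (auto simp: pairwise_def orthogonal_def inner_commute)
  \<comment> \<open>When \<open>l = 0\<close> the two elements coincide, and the independent pair
    \<open>u\<close>, \<open>v\<close> supplies multiplicity two.\<close>
  then have two: "2 \<le> dim (eigenspace A 0)" if "l = 0"
    using dim_subset[of "{u, v}" "eigenspace A 0"] dim_eq_card_independent[of "{u, v}"] u0 vl that uv
    by simp
  have "{#0, l#} \<subseteq># eigenvalue_mset A"
    using sub1[OF u0] sub1[OF vl] two ker v
    by (auto simp: subseteq_mset_def count_eigenvalue_mset[OF sym])
  then show thesis using that v min by blast
qed

text \<open>Semidefiniteness gives \<open>0 \<le> l\<close> for the minimal eigenvalue
  \<open>l\<close> on the complement of \<open>u\<close>. So 0 and \<open>l\<close> are two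
  eigenvalues bounded by \<open>l\<close>, which in turn is at most the Rayleigh quotient at
  \<open>x\<close>.\<close>

lemma second_smallest_eigenvalue_le:
  fixes A :: "real^'n^'n"
  assumes sym: "transpose A = A" and ker: "A *v u = 0" "u \<noteq> 0"
    and psd: "\<And>x. 0 \<le> x \<bullet> (A *v x)" and x: "x \<bullet> u = 0"
  shows "second_smallest_eigenvalue A * (x \<bullet> x) \<le> x \<bullet> (A *v x)"
proof (cases "x = 0")
  case False
  obtain v l where v: "v \<noteq> 0" "A *v v = l *\<^sub>R v" and sub: "{#0, l#} \<subseteq># eigenvalue_mset A"
    and min: "l * (x \<bullet> x) \<le> x \<bullet> (A *v x)"
    using symmetric_kernel_eigenvalues[OF sym ker x False] x by metis
  have "0 \<le> l * (v \<bullet> v)" using psd[of v] v(2) by simp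
  then have "0 \<le> l" using v(1) by (metis inner_gt_zero_iff zero_le_mult_iff not_le)
  then have "second_smallest_eigenvalue A \<le> l"
    unfolding second_smallest_eigenvalue_def using second_sorted_le[OF sub] by simp
  then show ?thesis using min mult_right_mono[of _ l "x \<bullet> x"] by fastforce
qed simp

text \<open>An eigenvector with eigenvalue below \<open>m\<close> must be a multiple of
  \<open>u\<close>. Hence 0 is the only possible eigenvalue below \<open>m\<close>, with
  multiplicity at most one.\<close>

lemma second_smallest_eigenvalue_ge:
  fixes A :: "real^'n^'n"
  assumes sym: "transpose A = A" and ker: "A *v u = 0" "u \<noteq> 0" and z: "z \<bullet> u = 0" "z \<noteq> 0"
    and ge: "\<And>x. x \<bullet> u = 0 \<Longrightarrow> m * (x \<bullet> x) \<le> x \<bullet> (A *v x)"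
  shows "m \<le> second_smallest_eigenvalue A"
proof -
  obtain l where sub: "{#0, l#} \<subseteq># eigenvalue_mset A"
    using symmetric_kernel_eigenvalues[OF sym ker z] by metis
  have small: "\<exists>c. v = c *\<^sub>R u" if v: "v \<in> eigenspace A l" and l: "l < m" for v l
  proof -
    \<comment> \<open>\<open>w\<close> is the component of \<open>v\<close> orthogonal to
      \<open>u\<close>; its Rayleigh quotient would be \<open>l < m\<close>, so it vanishes.\<close>
    define c where "c = (v \<bullet> u) / (u \<bullet> u)"
    define w where "w = v - c *\<^sub>R u"
    have w: "w \<bullet> u = 0" using ker by (simp add: w_def c_def inner_diff_left)
    have "A *v w = l *\<^sub>R v"
      using v ker by (simp add: w_def eigenspace_def matrix_vector_mult_diff_distrib matrix_vector_mult_scaleR)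
    then have "w \<bullet> (A *v w) = l * (w \<bullet> w)"
      using w by (simp add: w_def inner_diff_right)
    then have "(m - l) * (w \<bullet> w) \<le> 0" using ge[OF w] by (simp add: left_diff_distrib)
    then have "w = 0" using l by (simp add: mult_le_0_iff) (smt (verit) inner_ge_zero inner_eq_zero_iff)
    then show ?thesis by (auto simp: w_def)
  qed
  have "dim (eigenspace A l) \<le> (if l = 0 then 1 else 0)" if "l < m" for l
  proof -
    have "eigenspace A l \<subseteq> span {u}"
      using small[OF _ that] by (auto simp: span_singleton)
    then have "dim (eigenspace A l) \<le> dim (span {u})" by (rule dim_subset)
    then have 1: "dim (eigenspace A l) \<le> 1" using ker by simp
    have "eigenspace A l \<subseteq> {0}" if "l \<noteq> 0"
    proof
      fix v assume v: "v \<in> eigenspace A l"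
      then obtain c where "v = c *\<^sub>R u" using small \<open>l < m\<close> by blast
      then have "A *v v = 0" using ker by (simp add: matrix_vector_mult_scaleR)
      then show "v \<in> {0}" using v that by (simp add: eigenspace_def)
    qed
    then show ?thesis using 1 by (auto simp: dim_eq_0)
  qed
  then have "filter_mset (\<lambda>x. x < m) (eigenvalue_mset A) \<subseteq># {#0#}"
    by (fastforce simp add: subseteq_mset_def count_eigenvalue_mset[OF sym] simp del: dim_eq_0 split: if_splits)
  moreover have "2 \<le> size (eigenvalue_mset A)" using size_mset_mono[OF sub] by simp
  ultimately show ?thesis
    unfolding second_smallest_eigenvalue_def by (intro second_sorted_ge)
qed

lemma second_smallest_eigenvalue_eqI:
  fixes A :: "real^'t^'t"
  assumes sym: "transpose A = A" and ker: "A *v u = 0" "u \<noteq> 0"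
    and psd: "\<And>x. 0 \<le> x \<bullet> (A *v x)" and z: "z \<bullet> u = 0" "z \<noteq> 0"
    and att: "z \<bullet> (A *v z) = m * (z \<bullet> z)"
    and ge: "\<And>x. x \<bullet> u = 0 \<Longrightarrow> m * (x \<bullet> x) \<le> x \<bullet> (A *v x)"
  shows "second_smallest_eigenvalue A = m"
proof (rule antisym)
  show "second_smallest_eigenvalue A \<le> m"
    using second_smallest_eigenvalue_le[OF sym ker psd z(1)] z(2)
    unfolding att by (simp add: mult_le_cancel_right not_le)
  show "m \<le> second_smallest_eigenvalue A"
    by (rule second_smallest_eigenvalue_ge[OF sym ker z ge])
qed

section \<open>Quadratic forms of the information matrices\<close>

abbreviation ones :: "real^'n" where
  "ones \<equiv> (\<chi> i. 1)"

lemma sum_matrix_vector_mult: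
  "(\<Sum>s\<in>S. f s) *v (v :: real^'n) = (\<Sum>s\<in>S. f s *v v)"
  by (induction S rule: infinite_finite_induct) (simp_all add: matrix_vector_mult_add_rdistrib)

lemma matrix_sum_scaleR_mult:
  "(\<Sum>s\<in>S. p s *\<^sub>R f s) *v (v :: real^'n) = (\<Sum>s\<in>S. p s *\<^sub>R (f s *v v))"
  by (simp add: sum_matrix_vector_mult scaleR_matrix_vector_assoc)

lemma matrix_entry_inner: "A $ i $ j = axis i 1 \<bullet> (A *v (axis j 1 :: real^'n))"
  by (simp add: inner_axis' matrix_vector_mult_basis column_def)

lemma symmetric_matrixI:
  fixes A :: "real^'n^'n"
  assumes "\<And>x y. x \<bullet> (A *v y) = y \<bullet> (A *v x)"
  shows "transpose A = A"
  using assms by (simp add: vec_eq_iff transpose_def matrix_entry_inner)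

lemma ones_mat_mult: "ones_mat *v x = (ones \<bullet> x) *\<^sub>R ones"
  by (simp add: ones_mat_def matrix_vector_mult_def inner_vec_def vec_eq_iff)

lemma centering_mult: "centering *v x = x - ((ones \<bullet> x) / real CARD('n)) *\<^sub>R (ones :: real^'n)"
  by (simp add: centering_def matrix_vector_mult_diff_rdistrib ones_mat_mult
      flip: scaleR_matrix_vector_assoc)

lemma ones_inner_ones: "ones \<bullet> (ones :: real^'n) = real CARD('n)"
  by (simp add: inner_vec_def)

lemma centering_ones: "centering *v (ones :: real^'n) = 0"
  by (simp add: centering_mult ones_inner_ones)

lemma centering_ident: "ones \<bullet> x = 0 \<Longrightarrow> centering *v x = x"
  by (simp add: centering_mult)

lemma ones_inner_centering: "ones \<bullet> (centering *v x) = 0"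
  by (simp add: centering_mult inner_diff_right ones_inner_ones)

lemma centering_entry: "centering $ i $ j = (if i = j then 1 else 0) - 1 / real CARD('n)"
  for i j :: "'n::finite"
  by (simp add: centering_def ones_mat_def mat_def)

lemma transpose_centering: "transpose centering = centering"
  by (simp add: vec_eq_iff transpose_def centering_entry)

lemma inner_centering: "x \<bullet> (centering *v y) = (centering *v x) \<bullet> (centering *v y)"
  by (simp add: centering_mult inner_diff_left inner_diff_right ones_inner_ones inner_commute)

text \<open>The factor \<open>centering\<close> is absorbed, so that \<open>C_hat_seq\<close> and
  \<open>G_des\<close> become expressions in the same matrices.\<close>

definition eff_mat :: "effect \<Rightarrow> ('p::{finite,linorder} \<Rightarrow> 't::finite) \<Rightarrow> ('p, 't) mat" where
  "eff_mat e s = G_seq e s ** centering"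

lemma eff_mat_ones: "eff_mat e s *v ones = 0"
  by (simp add: eff_mat_def centering_ones flip: matrix_vector_mul_assoc)

text \<open>The C-matrices are handled through their values \<open>u \<bullet> (C *v v)\<close>, all
  of which are combinations of values of this form.\<close>

definition bform :: "('p::finite) sqmat \<Rightarrow> real^'p \<Rightarrow> real^'p \<Rightarrow> real" where
  "bform \<Sigma> x y = x \<bullet> (B_tilde \<Sigma> *v y)"

lemma bform_add_left: "bform \<Sigma> (x + y) z = bform \<Sigma> x z + bform \<Sigma> y z"
  and bform_add_right: "bform \<Sigma> z (x + y) = bform \<Sigma> z x + bform \<Sigma> z y"
  and bform_diff_left: "bform \<Sigma> (x - y) z = bform \<Sigma> x z - bform \<Sigma> y z"
  and bform_diff_right: "bform \<Sigma> z (x - y) = bform \<Sigma> z x - bform \<Sigma> z y"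
  and bform_scaleR_left: "bform \<Sigma> (c *\<^sub>R x) z = c * bform \<Sigma> x z"
  and bform_scaleR_right: "bform \<Sigma> z (c *\<^sub>R x) = c * bform \<Sigma> z x"
  and bform_sum_left: "bform \<Sigma> (\<Sum>i\<in>I. f i) z = (\<Sum>i\<in>I. bform \<Sigma> (f i) z)"
  by (simp_all add: bform_def inner_add_left inner_add_right inner_diff_left inner_diff_right
      inner_sum_left matrix_vector_right_distrib matrix_vector_mult_diff_distrib
      matrix_vector_mult_scaleR)

lemmas bform_linear = bform_add_left bform_add_right bform_diff_left bform_diff_right
  bform_scaleR_left bform_scaleR_right

lemma C_hat_seq_form:
  "u \<bullet> (C_hat_seq \<Sigma> s i j *v v) = bform \<Sigma> (eff_mat i s *v u) (eff_mat j s *v v)"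
proof -
  have "C_hat_seq \<Sigma> s i j = transpose (eff_mat i s) ** B_tilde \<Sigma> ** eff_mat j s"
    by (simp add: C_hat_seq_def eff_mat_def matrix_transpose_mul transpose_centering matrix_mul_assoc)
  then show ?thesis
    by (simp add: bform_def inner_transpose_vector del: transpose_matrix_vector
        flip: matrix_vector_mul_assoc)
qed

lemma C_hat_des_form:
  "u \<bullet> (C_hat_des n \<Sigma> P i j *v v) =
     real n * (\<Sum>s\<in>UNIV. P s * bform \<Sigma> (eff_mat i s *v u) (eff_mat j s *v v))"
  by (simp add: C_hat_des_def matrix_sum_scaleR_mult inner_sum_right C_hat_seq_form
      flip: scaleR_matrix_vector_assoc)

lemma G_des_mult: "G_des P i *v u = (\<Sum>s\<in>UNIV. P s *\<^sub>R (eff_mat i s *v u))"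
  by (simp add: G_des_def eff_mat_def matrix_sum_scaleR_mult)

text \<open>With \<open>P\<close> as weights this is a covariance: the mean of a product minus the
  product of the means, scaled by \<open>n\<close>.\<close>

lemma C_des_form:
  "u \<bullet> (C_des n \<Sigma> P i j *v v) =
     real n * ((\<Sum>s\<in>UNIV. P s * bform \<Sigma> (eff_mat i s *v u) (eff_mat j s *v v))
       - bform \<Sigma> (G_des P i *v u) (G_des P j *v v))"
proof -
  have "u \<bullet> (C_des n \<Sigma> P i j *v v) = u \<bullet> (C_hat_des n \<Sigma> P i j *v v)
      - real n * (u \<bullet> ((transpose (G_des P i) ** B_tilde \<Sigma> ** G_des P j) *v v))"
    by (simp add: C_des_def matrix_vector_mult_diff_rdistrib inner_diff_right
        flip: scaleR_matrix_vector_assoc)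
  also have "u \<bullet> ((transpose (G_des P i) ** B_tilde \<Sigma> ** G_des P j) *v v)
      = bform \<Sigma> (G_des P i *v u) (G_des P j *v v)"
    by (simp add: bform_def inner_transpose_vector del: transpose_matrix_vector
        flip: matrix_vector_mul_assoc)
  finally show ?thesis by (simp add: C_hat_des_form right_diff_distrib)
qed

lemma C_des_ones: "C_des n \<Sigma> P i j *v ones = 0"
proof -
  have "x \<bullet> (C_des n \<Sigma> P i j *v ones) = 0" for x
    unfolding C_des_form G_des_mult by (simp add: eff_mat_ones bform_def)
  from this[of "C_des n \<Sigma> P i j *v ones"] show ?thesis by simp
qed

section \<open>Positivity of the form of \<open>B_tilde\<close>\<close>

lemma invertible_sym_pos_def:
  assumes "sym_pos_def \<Sigma>"
  shows "\<Sigma> ** matrix_inv \<Sigma> = mat 1"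
proof -
  have "x = 0" if "\<Sigma> *v x = 0" for x
    using assms that unfolding sym_pos_def_def by (metis inner_zero_right less_irrefl)
  then have "inj ((*v) \<Sigma>)"
    by (intro injI) (metis eq_iff_diff_eq_0 matrix_vector_mult_diff_distrib)
  then have "invertible \<Sigma>"
    by (simp add: matrix_left_invertible_injective invertible_left_inverse)
  \<comment> \<open>\<open>matrix_inv\<close> is a Hilbert choice and meets its specification once
    some inverse exists.\<close>
  then show ?thesis
    unfolding invertible_def matrix_inv_def by (metis (mono_tags, lifting) someI_ex)
qed

text \<open>Substituting x = \<Sigma> y turns the form of the inverse into that of \<Sigma>.\<close>

lemma sym_pos_def_matrix_inv:
  assumes spd: "sym_pos_def \<Sigma>"
  shows "sym_pos_def (matrix_inv \<Sigma>)"
proof -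
  let ?V = "matrix_inv \<Sigma>"
  have inv: "\<Sigma> *v (?V *v x) = x" for x
    by (simp add: matrix_vector_mul_assoc invertible_sym_pos_def[OF spd])
  have sym: "x \<bullet> (\<Sigma> *v y) = y \<bullet> (\<Sigma> *v x)" for x y
    using spd by (simp add: sym_pos_def_def symmetric_matrix_inner)
  have "transpose ?V = ?V"
    by (rule symmetric_matrixI) (metis inv sym inner_commute)
  moreover have "x \<bullet> (?V *v x) > 0" if "x \<noteq> 0" for x
  proof -
    have "?V *v x \<noteq> 0" using inv[of x] that by auto
    then have "(?V *v x) \<bullet> (\<Sigma> *v (?V *v x)) > 0" using spd by (simp add: sym_pos_def_def)
    then show ?thesis by (simp add: inv inner_commute)
  qed
  ultimately show ?thesis by (simp add: sym_pos_def_def)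
qed

context
  fixes \<Sigma> :: "('p::{finite,linorder}) sqmat"
  assumes spd: "sym_pos_def \<Sigma>"
begin

lemma matrix_inv_inner_commute: "x \<bullet> (matrix_inv \<Sigma> *v y) = y \<bullet> (matrix_inv \<Sigma> *v x)"
  using sym_pos_def_matrix_inv[OF spd] by (simp add: sym_pos_def_def symmetric_matrix_inner)

lemma matrix_inv_inner_ones_pos: "ones \<bullet> (matrix_inv \<Sigma> *v ones) > 0"
  using sym_pos_def_matrix_inv[OF spd] by (simp add: sym_pos_def_def vec_eq_iff)

lemma bform_eq:
  "bform \<Sigma> x y = x \<bullet> (matrix_inv \<Sigma> *v y) -
     (ones \<bullet> (matrix_inv \<Sigma> *v x)) * (ones \<bullet> (matrix_inv \<Sigma> *v y)) / (ones \<bullet> (matrix_inv \<Sigma> *v ones))"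
  by (simp add: bform_def B_tilde_def matrix_vector_mult_diff_rdistrib inner_diff_right ones_mat_mult
      matrix_vector_mult_scaleR matrix_inv_inner_commute[of x ones]
      flip: scaleR_matrix_vector_assoc matrix_vector_mul_assoc)

lemma bform_commute: "bform \<Sigma> x y = bform \<Sigma> y x"
  by (simp add: bform_eq matrix_inv_inner_commute[of x y])

text \<open>\<open>bform\<close> is the \<open>\<Sigma>\<close>-inverse inner product of the residuals after projecting out \<open>ones\<close>.\<close>

lemma bform_self:
  defines "c x \<equiv> (ones \<bullet> (matrix_inv \<Sigma> *v x)) / (ones \<bullet> (matrix_inv \<Sigma> *v ones))"
  shows "bform \<Sigma> x x = (x - c x *\<^sub>R ones) \<bullet> (matrix_inv \<Sigma> *v (x - c x *\<^sub>R ones))"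
  using matrix_inv_inner_ones_pos
  by (simp add: bform_eq matrix_vector_mult_diff_distrib matrix_vector_mult_scaleR inner_diff_left
      inner_diff_right matrix_inv_inner_commute[of x ones] c_def field_simps power2_eq_square)

lemma bform_nonneg: "0 \<le> bform \<Sigma> x x"
  using sym_pos_def_matrix_inv[OF spd] unfolding bform_self sym_pos_def_def
  by (metis inner_zero_left less_imp_le order_refl)

text \<open>The residual of \<open>x\<close> after removing a multiple of \<open>ones\<close>
  vanishes only for constant vectors, so two differing entries certify positivity.\<close>

lemma bform_pos:
  assumes "x $ k \<noteq> x $ l"
  shows "0 < bform \<Sigma> x x"
proof -
  let ?c = "(ones \<bullet> (matrix_inv \<Sigma> *v x)) / (ones \<bullet> (matrix_inv \<Sigma> *v ones))"
  have "x - ?c *\<^sub>R ones \<noteq> 0"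
    using assms by (simp add: vec_eq_iff) metis
  then show ?thesis
    using sym_pos_def_matrix_inv[OF spd] unfolding bform_self sym_pos_def_def by blast
qed

lemma C_des_form_commute:
  "u \<bullet> (C_des n \<Sigma> P i j *v v) = v \<bullet> (C_des n \<Sigma> P j i *v u)"
  unfolding C_des_form
  by (simp add: bform_commute[of "eff_mat i _ *v u"] bform_commute[of "G_des P i *v u"])

section \<open>Joint form of direct and carryover effects, and the information matrix\<close>

text \<open>The Steiner identity: a mean square minus the square of the mean is the mean square
  deviation, which is visibly nonnegative.\<close>

lemma bform_variance:
  fixes p :: "'s \<Rightarrow> real" and z :: "'s \<Rightarrow> (real,'p) vec"
  assumes "(\<Sum>s\<in>S. p s) = 1"
  defines "m \<equiv> \<Sum>s\<in>S. p s *\<^sub>R z s"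
  shows "(\<Sum>s\<in>S. p s * bform \<Sigma> (z s) (z s)) - bform \<Sigma> m m =
    (\<Sum>s\<in>S. p s * bform \<Sigma> (z s - m) (z s - m))"
proof -
  have m: "(\<Sum>s\<in>S. p s * bform \<Sigma> (z s) m) = bform \<Sigma> m m"
    by (simp add: bform_sum_left bform_scaleR_left m_def)
  have "(\<Sum>s\<in>S. p s * bform \<Sigma> (z s - m) (z s - m)) =
    (\<Sum>s\<in>S. p s * bform \<Sigma> (z s) (z s) - 2 * (p s * bform \<Sigma> (z s) m) + p s * bform \<Sigma> m m)"
    by (intro sum.cong) (simp_all add: bform_linear bform_commute[of m "z _"] algebra_simps)
  also have "\<dots> = (\<Sum>s\<in>S. p s * bform \<Sigma> (z s) (z s)) - 2 * bform \<Sigma> m m + (\<Sum>s\<in>S. p s) * bform \<Sigma> m m"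
    by (simp add: sum.distrib sum_subtractf m sum_distrib_right flip: sum_distrib_left)
  finally show ?thesis using assms by simp
qed

text \<open>The quadratic form of the 2 by 2 block matrix of the \<open>C_des\<close> at the stacked
  vector of direct effects \<open>u\<close> and carryover effects \<open>v\<close>.\<close>

definition joint_form :: "nat \<Rightarrow> ('p, 't::finite) design \<Rightarrow> real^'t \<Rightarrow> real^'t \<Rightarrow> real" where
  "joint_form n P u v = u \<bullet> (C_des n \<Sigma> P Direct Direct *v u)
     + 2 * (u \<bullet> (C_des n \<Sigma> P Direct Carryover *v v)) + v \<bullet> (C_des n \<Sigma> P Carryover Carryover *v v)"

lemma joint_form_eq:
  "joint_form n P u v = real n *
     ((\<Sum>s\<in>UNIV. P s * bform \<Sigma> (eff_mat Direct s *v u + eff_mat Carryover s *v v)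
        (eff_mat Direct s *v u + eff_mat Carryover s *v v))
      - bform \<Sigma> (\<Sum>s\<in>UNIV. P s *\<^sub>R (eff_mat Direct s *v u + eff_mat Carryover s *v v))
        (\<Sum>s\<in>UNIV. P s *\<^sub>R (eff_mat Direct s *v u + eff_mat Carryover s *v v)))"
proof -
  have "(\<Sum>s\<in>UNIV. P s *\<^sub>R (eff_mat Direct s *v u + eff_mat Carryover s *v v)) =
      G_des P Direct *v u + G_des P Carryover *v v"
    by (simp add: G_des_mult scaleR_add_right sum.distrib)
  then show ?thesis
    by (simp add: joint_form_def C_des_form bform_linear sum.distrib
        bform_commute[of "eff_mat Carryover _ *v v" "eff_mat Direct _ *v u"]
        bform_commute[of "G_des P Carryover *v v" "G_des P Direct *v u"]
        algebra_simps sum_distrib_left)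
qed

lemma joint_form_nonneg:
  assumes "approx_design P"
  shows "0 \<le> joint_form n P u v"
  unfolding joint_form_eq using assms
  by (subst bform_variance) (auto simp: approx_design_def intro!: mult_nonneg_nonneg sum_nonneg bform_nonneg)

text \<open>The square of the mean is dropped. Nothing is lost when the matrices
  \<open>G_des\<close> vanish.\<close>

lemma joint_form_le:
  "joint_form n P u v \<le> real n *
     (\<Sum>s\<in>UNIV. P s * bform \<Sigma> (eff_mat Direct s *v u + eff_mat Carryover s *v v)
        (eff_mat Direct s *v u + eff_mat Carryover s *v v))"
  unfolding joint_form_eq by (intro mult_left_mono) (simp_all add: bform_nonneg)

text \<open>The outer product splits the correction into two linear functionals. The case
  distinction of \<open>info_mat\<close> disappears because division by \<open>r \<tau> = 0\<close>
  yields 0.\<close>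

lemma info_mat_form:
  fixes P :: "('p, 't::finite) design" and n :: nat and lam :: real
  defines "X v w \<equiv> v \<bullet> (C_des n \<Sigma> P Direct Carryover *v w) + lam * (v \<bullet> (C_des n \<Sigma> P Carryover Carryover *v w))"
    and "r w \<equiv> w \<bullet> (C_des n \<Sigma> P Carryover Carryover *v w)"
  shows "u \<bullet> (info_mat n \<Sigma> P \<tau> lam *v v) =
    u \<bullet> (C_des n \<Sigma> P Direct Direct *v v) + lam * (u \<bullet> (C_des n \<Sigma> P Direct Carryover *v v)
      + v \<bullet> (C_des n \<Sigma> P Direct Carryover *v u)) + lam\<^sup>2 * (u \<bullet> (C_des n \<Sigma> P Carryover Carryover *v v))
      - X u \<tau> * X v \<tau> / r \<tau>"
proof -
  have outer: "(\<chi> i j. \<tau> $ i * \<tau> $ j) *v w = (\<tau> \<bullet> w) *\<^sub>R \<tau>" for w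
    by (simp add: vec_eq_iff matrix_vector_mult_def inner_vec_def sum_distrib_left mult_ac)
  have "\<tau> \<bullet> (C_des n \<Sigma> P Carryover Direct *v v) + lam * (\<tau> \<bullet> (C_des n \<Sigma> P Carryover Carryover *v v)) = X v \<tau>"
    by (simp add: X_def C_des_form_commute[of \<tau> _ _ _ _ v])
  then show ?thesis
    by (simp add: info_mat_def Let_def r_def[symmetric] matrix_vector_mult_diff_rdistrib
        matrix_vector_mult_add_rdistrib inner_diff_right inner_add_right outer
        matrix_vector_mult_scaleR C_des_form_commute[of u n P Carryover Direct] X_def
        flip: scaleR_matrix_vector_assoc matrix_vector_mul_assoc)
qed

lemma transpose_info_mat: "transpose (info_mat n \<Sigma> P \<tau> lam) = info_mat n \<Sigma> P \<tau> lam"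
  by (rule symmetric_matrixI)
    (simp add: info_mat_form C_des_form_commute[of _ _ _ Direct Direct]
      C_des_form_commute[of _ _ _ Carryover Carryover] algebra_simps)

lemma info_mat_ones: "info_mat n \<Sigma> P \<tau> lam *v ones = 0"
proof -
  have [simp]: "ones \<bullet> (C_des n \<Sigma> P i j *v w) = 0" for i j w
    by (simp add: C_des_form_commute[of ones] C_des_ones)
  have "x \<bullet> (info_mat n \<Sigma> P \<tau> lam *v ones) = 0" for x
    by (simp add: info_mat_form C_des_ones)
  from this[of "info_mat n \<Sigma> P \<tau> lam *v ones"] show ?thesis by simp
qed

text \<open>For an approximate design, the minimum of this parabola in \<open>y\<close> is the value
  of the form of \<open>info_mat\<close> at \<open>v\<close>: constant term minus squared half
  linear coefficient over leading coefficient.\<close>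

lemma joint_form_line:
  "joint_form n P v (lam *\<^sub>R v + y *\<^sub>R \<tau>) =
    v \<bullet> (C_des n \<Sigma> P Direct Direct *v v) + lam * (v \<bullet> (C_des n \<Sigma> P Direct Carryover *v v)
      + v \<bullet> (C_des n \<Sigma> P Direct Carryover *v v)) + lam\<^sup>2 * (v \<bullet> (C_des n \<Sigma> P Carryover Carryover *v v))
    + 2 * (v \<bullet> (C_des n \<Sigma> P Direct Carryover *v \<tau>) + lam * (v \<bullet> (C_des n \<Sigma> P Carryover Carryover *v \<tau>))) * y
    + (\<tau> \<bullet> (C_des n \<Sigma> P Carryover Carryover *v \<tau>)) * y\<^sup>2"
  by (simp add: joint_form_def matrix_vector_right_distrib matrix_vector_mult_scaleR inner_add_left
      inner_add_right C_des_form_commute[of \<tau> _ _ Carryover Carryover v] algebra_simps power2_eq_square)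

lemma C_des_Carryover_nonneg:
  assumes "approx_design P"
  shows "0 \<le> v \<bullet> (C_des n \<Sigma> P Carryover Carryover *v v)"
  using joint_form_nonneg[OF assms, of n 0 v] by (simp add: joint_form_def)

text \<open>The parabola of \<open>joint_form_line\<close> is nonnegative, so its discriminant bound
  says that the correction does not exceed the constant term.\<close>

lemma info_mat_nonneg:
  assumes P: "approx_design P"
  shows "0 \<le> v \<bullet> (info_mat n \<Sigma> P \<tau> lam *v v)"
proof -
  \<comment> \<open>The dummy stays schematic, so the fact covers every point of the line.\<close>
  note * = joint_form_nonneg[OF P, of n v "lam *\<^sub>R v + _ *\<^sub>R \<tau>", unfolded joint_form_line]
  note d = quadratic_discriminant_le[OF * C_des_Carryover_nonneg[OF P]]
  show ?thesis
    unfolding info_mat_form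
    using d *[of 0] C_des_Carryover_nonneg[OF P, where n = n and v = \<tau>]
    by (cases "\<tau> \<bullet> (C_des n \<Sigma> P Carryover Carryover *v \<tau>) = 0")
      (simp_all add: power2_eq_square divide_le_eq)
qed

text \<open>For \<open>v = \<tau>\<close> the line of \<open>joint_form_line\<close> runs through
  all multiples of \<tau> in the carryover argument, so the minimum is below the value at any chosen
  \<open>x\<close>.\<close>

lemma info_mat_le_joint_form:
  assumes P: "approx_design P"
  shows "\<tau> \<bullet> (info_mat n \<Sigma> P \<tau> lam *v \<tau>) \<le> joint_form n P \<tau> (x *\<^sub>R \<tau>)"
proof -
  note * = joint_form_nonneg[OF P, of n \<tau> "lam *\<^sub>R \<tau> + _ *\<^sub>R \<tau>", unfolded joint_form_line]
  define r where "r = \<tau> \<bullet> (C_des n \<Sigma> P Carryover Carryover *v \<tau>)"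
  define b where "b = \<tau> \<bullet> (C_des n \<Sigma> P Direct Carryover *v \<tau>) + lam * r"
  have r: "0 \<le> r" using C_des_Carryover_nonneg[OF P] by (simp add: r_def)
  \<comment> \<open>A nonnegative parabola without quadratic term has no linear term, which matches
    the default value of \<open>b * b / r\<close>.\<close>
  have b0: "b = 0" if "r = 0"
    using quadratic_discriminant_le[OF * C_des_Carryover_nonneg[OF P]] that
    by (simp add: b_def r_def)
  have "- (b * b / r) \<le> 2 * b * y + r * y\<^sup>2" for y
  proof (cases "r = 0")
    case False
    have "0 \<le> r * (y + b / r)\<^sup>2" using r by simp
    also have "\<dots> = 2 * b * y + r * y\<^sup>2 + b * b / r"
      using False by (simp add: field_simps power2_eq_square)
    finally show ?thesis by simp
  qed (simp add: b0)
  \<comment> \<open>The carryover argument \<open>x \<tau>\<close> corresponds to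
    \<open>y = x - lam\<close>.\<close>
  from this[of "x - lam"] have "\<tau> \<bullet> (info_mat n \<Sigma> P \<tau> lam *v \<tau>) \<le> joint_form n P \<tau> (lam *\<^sub>R \<tau> + (x - lam) *\<^sub>R \<tau>)"
    unfolding joint_form_line info_mat_form r_def[symmetric] b_def[symmetric] by simp
  then show ?thesis by (simp flip: scaleR_add_left)
qed

end

section \<open>Treatment relabelling and balanced designs\<close>

text \<open>Invariance makes the diagonal constant and the off-diagonal entries constant; zero row
  sums link the two values, and the trace fixes the scale.\<close>

lemma permutation_invariant_matrix:
  fixes A :: "real^'t^'t"
  assumes card: "2 \<le> CARD('t)"
    and inv: "\<And>\<pi> i j. bij \<pi> \<Longrightarrow> A $ \<pi> i $ \<pi> j = A $ i $ j"
    and row: "A *v ones = 0"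
  shows "A = (trace A / (real CARD('t) - 1)) *\<^sub>R centering"
proof -
  let ?t = "real CARD('t)"
  have diag: "A $ i $ i = trace A / ?t" for i
  proof -
    have "A $ j $ j = A $ i $ i" for j
      using inv[of "Transposition.transpose i j" i i] by simp
    then have "trace A = (\<Sum>j\<in>(UNIV :: 't set). A $ i $ i)"
      unfolding trace_def by (intro sum.cong) auto
    then show ?thesis by simp
  qed
  have off: "A $ i $ j = - (trace A / ?t) / (?t - 1)" if "i \<noteq> j" for i j
  proof -
    \<comment> \<open>The transposition of \<open>j\<close> and \<open>k\<close> fixes
      \<open>i\<close>.\<close>
    have "A $ i $ k = A $ i $ j" if "k \<noteq> i" for k
      using inv[of "Transposition.transpose j k" i j] that \<open>i \<noteq> j\<close>
      by (simp add: transpose_apply_other)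
    then have "(\<Sum>k\<in>UNIV - {i}. A $ i $ k) = (\<Sum>k\<in>UNIV - {i}. A $ i $ j)"
      by (intro sum.cong) auto
    also have "\<dots> = (?t - 1) * A $ i $ j"
      using card by (simp add: card_Diff_subset of_nat_diff)
    finally have "(\<Sum>k\<in>UNIV. A $ i $ k) = A $ i $ i + (?t - 1) * A $ i $ j"
      by (simp add: sum.remove[of UNIV i])
    moreover have "(\<Sum>k\<in>UNIV. A $ i $ k) = 0"
      using row by (simp add: matrix_vector_mult_def vec_eq_iff)
    ultimately have "(?t - 1) * A $ i $ j = - (trace A / ?t)" using diag[of i] by simp
    moreover have "?t - 1 \<noteq> 0" using card by simp
    ultimately show ?thesis by (metis nonzero_mult_div_cancel_left)
  qed
  show ?thesis
  proof (unfold vec_eq_iff, intro allI)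
    fix i j
    show "A $ i $ j = ((trace A / (?t - 1)) *\<^sub>R centering) $ i $ j"
      using diag[of i] off[of i j] card
      by (cases "i = j") (auto simp: centering_entry divide_simps algebra_simps)
  qed
qed

lemma trace_scaleR: "trace (c *\<^sub>R A) = c * trace A"
  by (simp add: trace_def sum_distrib_left)

lemma trace_sum: "trace (\<Sum>s\<in>S. f s) = (\<Sum>s\<in>S. trace (f s))"
  by (simp add: trace_def sum.swap[of _ S])

lemma trace_C_hat_des: "trace (C_hat_des n \<Sigma> P i j) = c_des n \<Sigma> P i j"
  by (simp add: C_hat_des_def c_des_def c_seq_def trace_scaleR trace_sum)

text \<open>The period whose treatment acts in period \<open>k\<close>. This treats both effects
  uniformly; \<open>None\<close> stands for the zero first row of \<open>F_mat\<close>.\<close>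

fun source :: "effect \<Rightarrow> 'p::{finite,linorder} \<Rightarrow> 'p option" where
  "source Direct k = Some k"
| "source Carryover k = (if {..<k} \<noteq> {} then Some (Max {..<k}) else None)"

lemma eff_mat_entry:
  "eff_mat e s $ k $ a = (case source e k of None \<Rightarrow> 0 | Some l \<Rightarrow> centering $ s l $ a)"
  by (cases e)
    (simp_all add: eff_mat_def matrix_matrix_mult_def T_mat_def F_mat_def if_distrib[of "\<lambda>x. x * _"] cong: if_cong)

lemma eff_mat_axis: "eff_mat e s *v axis a 1 = (\<chi> k. eff_mat e s $ k $ a)"
  by (simp add: matrix_vector_mult_basis column_def)

lemma C_hat_seq_entry:
  "C_hat_seq \<Sigma> s i j $ a $ b = bform \<Sigma> (eff_mat i s *v axis a 1) (eff_mat j s *v axis b 1)"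
  by (simp add: matrix_entry_inner C_hat_seq_form)

text \<open>An entry of \<open>centering\<close> depends only on whether its indices agree, which a
  bijection preserves.\<close>

lemma eff_mat_relabel:
  fixes \<pi> :: "'t::finite \<Rightarrow> 't"
  assumes "bij \<pi>"
  shows "eff_mat e (\<pi> \<circ> s) *v axis (\<pi> a) 1 = eff_mat e s *v axis a 1"
  using bij_is_inj[OF assms]
  by (auto simp: eff_mat_axis vec_eq_iff eff_mat_entry centering_entry inj_eq split: option.split)

lemma C_hat_seq_relabel:
  fixes \<pi> :: "'t::finite \<Rightarrow> 't"
  assumes "bij \<pi>"
  shows "C_hat_seq \<Sigma> (\<pi> \<circ> s) i j $ \<pi> a $ \<pi> b = C_hat_seq \<Sigma> s i j $ a $ b"
  by (simp add: C_hat_seq_entry eff_mat_relabel[OF assms])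

lemma c_seq_relabel:
  fixes \<pi> :: "'t::finite \<Rightarrow> 't"
  assumes "bij \<pi>"
  shows "c_seq \<Sigma> (\<pi> \<circ> s) i j = c_seq \<Sigma> s i j"
  unfolding c_seq_def trace_def
  using sum.reindex_bij_betw[OF assms, of "\<lambda>a. C_hat_seq \<Sigma> (\<pi> \<circ> s) i j $ a $ a"]
  by (simp add: C_hat_seq_relabel[OF assms])

text \<open>
  All that is used of pseudo symmetry. Unlike pseudo symmetry, it is stated by conditions that are
  evidently linear in the design.
\<close>

definition balanced :: "nat \<Rightarrow> 'p sqmat \<Rightarrow> ('p::{finite,linorder}, 't::finite) design \<Rightarrow> bool" where
  "balanced n \<Sigma> P \<longleftrightarrow> (\<forall>i. G_des P i = 0) \<and>
     (\<forall>i j. C_hat_des n \<Sigma> P i j = (c_des n \<Sigma> P i j / (real CARD('t) - 1)) *\<^sub>R centering)"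

lemma balanced_C_des:
  fixes P :: "('p::{finite,linorder}, 't::finite) design"
  assumes "balanced n \<Sigma> P"
  shows "C_des n \<Sigma> P i j = (c_des n \<Sigma> P i j / (real CARD('t) - 1)) *\<^sub>R centering"
  using assms by (simp add: balanced_def C_des_def)

lemma G_des_entry: "G_des P e $ k $ a = (\<Sum>s\<in>UNIV. P s * eff_mat e s $ k $ a)"
  by (simp add: G_des_def eff_mat_def)

lemma sum_centering: "(\<Sum>i\<in>UNIV. centering $ i $ a) = 0"
  by (simp add: centering_entry sum_subtractf)

text \<open>Equal replication averages the rows of \<open>centering\<close> to zero, in each period
  and hence also for carryover rows. So \<open>C_des\<close> equals \<open>C_hat_des\<close>; being
  completely symmetric with zero row sums, it is determined by its trace.\<close>

lemma pseudo_symmetric_balanced: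
  fixes P :: "('p::{finite,linorder}, 't::finite) design"
  assumes card: "2 \<le> CARD('t)" and P: "pseudo_symmetric n \<Sigma> P"
  shows "balanced n \<Sigma> P"
proof -
  have rep: "(\<Sum>s\<in>UNIV. P s * centering $ s l $ a) = 0" for l a
  proof -
    \<comment> \<open>Sequences are grouped by the treatment in period \<open>l\<close>.\<close>
    have "(\<Sum>s\<in>UNIV. P s * centering $ s l $ a) =
        (\<Sum>i\<in>UNIV. \<Sum>s\<in>{s \<in> UNIV. s l = i}. P s * centering $ s l $ a)"
      by (rule sum.group[symmetric]) auto
    also have "\<dots> = (\<Sum>i\<in>UNIV. (\<Sum>s | s l = i. P s) * centering $ i $ a)"
      by (auto simp: sum_distrib_right intro!: sum.cong)
    also have "\<dots> = (1 / real CARD('t)) * (\<Sum>i\<in>UNIV. centering $ i $ a)"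
      using P by (simp add: pseudo_symmetric_def flip: sum_divide_distrib)
    finally show ?thesis by (simp add: sum_centering)
  qed
  have "G_des P e $ k $ a = 0" for e k a
    by (cases "source e k") (simp_all add: G_des_entry eff_mat_entry rep)
  then have G: "G_des P e = 0" for e by (simp add: vec_eq_iff)
  have "C_hat_des n \<Sigma> P i j = (c_des n \<Sigma> P i j / (real CARD('t) - 1)) *\<^sub>R centering" for i j
  proof -
    have eq: "C_des n \<Sigma> P i j = C_hat_des n \<Sigma> P i j" using G by (simp add: C_des_def)
    obtain a b where "C_des n \<Sigma> P i j = a *\<^sub>R mat 1 + b *\<^sub>R ones_mat"
      using P unfolding pseudo_symmetric_def completely_symmetric_def by blast
    then have "C_hat_des n \<Sigma> P i j $ \<pi> k $ \<pi> l = C_hat_des n \<Sigma> P i j $ k $ l"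
      if "bij \<pi>" for \<pi> k l
      using bij_is_inj[OF that] by (simp add: eq mat_def ones_mat_def inj_eq)
    from permutation_invariant_matrix[OF card this] show ?thesis
      using C_des_ones[of n \<Sigma> P i j] by (simp add: eq trace_C_hat_des)
  qed
  with G show ?thesis by (simp add: balanced_def)
qed

section \<open>Symmetrised sequences and mixtures of designs\<close>

text \<open>The uniform distribution on permutations, carried to sequences. It is uniform on the
  orbit of \<open>s\<close>, but expectations become sums over the group, without counting
  stabilisers.\<close>

definition relabelled_design :: "('p::finite \<Rightarrow> 't::finite) \<Rightarrow> ('p, 't) design" where
  "relabelled_design s s' =
     (\<Sum>\<pi> | bij \<pi>. if \<pi> \<circ> s = s' then 1 else 0) / real (card {\<pi> :: 't \<Rightarrow> 't. bij \<pi>})"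

lemma card_bij_pos: "0 < card {\<pi> :: 't::finite \<Rightarrow> 't. bij \<pi>}"
  using bij_id by (auto simp: card_gt_0_iff)

lemma relabelled_design_sum:
  fixes f :: "('p::finite \<Rightarrow> 't::finite) \<Rightarrow> 'v::real_vector"
  shows "(\<Sum>s'\<in>UNIV. relabelled_design s s' *\<^sub>R f s') =
    (1 / real (card {\<pi> :: 't \<Rightarrow> 't. bij \<pi>})) *\<^sub>R (\<Sum>\<pi> | bij \<pi>. f (\<pi> \<circ> s))"
proof -
  have "(\<Sum>s'\<in>UNIV. (\<Sum>\<pi> | bij \<pi>. if \<pi> \<circ> s = s' then 1 else 0 :: real) *\<^sub>R f s') =
      (\<Sum>\<pi> | bij \<pi>. \<Sum>s'\<in>UNIV. if s' = \<pi> \<circ> s then f s' else 0)"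
    by (subst sum.swap) (auto simp: scaleR_sum_left intro!: sum.cong)
  also have "\<dots> = (\<Sum>\<pi> | bij \<pi>. f (\<pi> \<circ> s))" by simp
  finally show ?thesis
    by (simp add: relabelled_design_def divide_inverse_commute flip: scaleR_scaleR scaleR_sum_right)
qed

lemma approx_design_relabelled: "approx_design (relabelled_design s)"
  using relabelled_design_sum[of s "\<lambda>_. 1 :: real"] card_bij_pos[where 't = 'a]
  by (auto simp: approx_design_def relabelled_design_def intro!: divide_nonneg_nonneg sum_nonneg)

lemma sum_bij_compose:
  fixes f :: "('a \<Rightarrow> 'b) \<Rightarrow> 'c::comm_monoid_add"
  assumes "bij \<sigma>"
  shows "(\<Sum>\<pi> | bij \<pi>. f (\<sigma> \<circ> \<pi>)) = (\<Sum>\<pi> | bij \<pi>. f \<pi>)"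
proof -
  have "bij_betw ((\<circ>) \<sigma>) {\<pi>. bij \<pi>} {\<pi>. bij \<pi>}"
  proof (rule bij_betwI[where g = "(\<circ>) (inv \<sigma>)"])
    show "(\<circ>) \<sigma> \<in> {\<pi>. bij \<pi>} \<rightarrow> {\<pi>. bij \<pi>}" "(\<circ>) (inv \<sigma>) \<in> {\<pi>. bij \<pi>} \<rightarrow> {\<pi>. bij \<pi>}"
      using assms by (auto intro: bij_comp bij_imp_bij_inv)
  qed (use assms in \<open>auto simp: fun_eq_iff bij_is_inj bij_is_surj surj_f_inv_f\<close>)
  from sum.reindex_bij_betw[OF this] show ?thesis .
qed

text \<open>Composing with a transposition of two columns shows that the sum is the same for every
  column, while the total over all columns is 0.\<close>

lemma sum_bij_centering: "(\<Sum>\<pi> | bij (\<pi> :: 't::finite \<Rightarrow> 't). centering $ \<pi> b $ a) = 0"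
proof -
  let ?S = "\<lambda>a. \<Sum>\<pi> | bij (\<pi> :: 't \<Rightarrow> 't). centering $ \<pi> b $ a"
  have const: "?S a' = ?S a" for a'
  proof -
    let ?\<tau> = "Transposition.transpose a a'"
    have "?S a' = (\<Sum>\<pi> | bij \<pi>. centering $ (?\<tau> \<circ> \<pi>) b $ a')"
      by (rule sum_bij_compose[symmetric]) simp
    also have "\<dots> = ?S a"
      by (intro sum.cong refl) (auto simp: centering_entry Transposition.transpose_def)
    finally show ?thesis .
  qed
  have "(\<Sum>a'\<in>UNIV. ?S a') = (\<Sum>a'\<in>(UNIV :: 't set). ?S a)"
    by (rule sum.cong[OF refl const])
  then have "(\<Sum>a'\<in>UNIV. ?S a') = real CARD('t) * ?S a" by simp
  moreover have "(\<Sum>a'\<in>UNIV. ?S a') = (\<Sum>\<pi> | bij (\<pi> :: 't \<Rightarrow> 't). \<Sum>a'\<in>UNIV. centering $ \<pi> b $ a')"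
    by (rule sum.swap)
  moreover have "(\<Sum>a'\<in>UNIV. centering $ c $ a') = 0" for c :: 't
    by (simp add: centering_entry sum_subtractf)
  ultimately show ?thesis by simp
qed

lemma balanced_relabelled:
  fixes s :: "'p::{finite,linorder} \<Rightarrow> 't::finite"
  assumes card: "2 \<le> CARD('t)"
  shows "balanced n \<Sigma> (relabelled_design s)"
proof -
  let ?N = "real (card {\<pi> :: 't \<Rightarrow> 't. bij \<pi>})"
  have "G_des (relabelled_design s) e $ k $ a = 0" for e k a
    using relabelled_design_sum[of s "\<lambda>s. eff_mat e s $ k $ a"]
    by (cases "source e k") (simp_all add: G_des_entry eff_mat_entry sum_bij_centering)
  then have G: "G_des (relabelled_design s) e = 0" for e by (simp add: vec_eq_iff)
  have "C_hat_des n \<Sigma> (relabelled_design s) i j =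
      (c_des n \<Sigma> (relabelled_design s) i j / (real CARD('t) - 1)) *\<^sub>R centering" for i j
  proof -
    have C: "C_hat_des n \<Sigma> (relabelled_design s) i j $ a $ b =
        real n / ?N * (\<Sum>\<pi> | bij \<pi>. C_hat_seq \<Sigma> (\<pi> \<circ> s) i j $ a $ b)" for a b
      by (simp add: C_hat_des_def relabelled_design_sum)
    have inv: "C_hat_des n \<Sigma> (relabelled_design s) i j $ \<sigma> a $ \<sigma> b =
        C_hat_des n \<Sigma> (relabelled_design s) i j $ a $ b" if \<sigma>: "bij \<sigma>" for \<sigma> a b
    proof -
      \<comment> \<open>Left translation by \<sigma> permutes the group, and \<sigma> then cancels
        against the relabelled indices.\<close>
      have "(\<Sum>\<pi> | bij \<pi>. C_hat_seq \<Sigma> (\<pi> \<circ> s) i j $ \<sigma> a $ \<sigma> b) =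
          (\<Sum>\<pi> | bij \<pi>. C_hat_seq \<Sigma> (\<sigma> \<circ> (\<pi> \<circ> s)) i j $ \<sigma> a $ \<sigma> b)"
        using sum_bij_compose[OF \<sigma>, of "\<lambda>\<pi>. C_hat_seq \<Sigma> (\<pi> \<circ> s) i j $ \<sigma> a $ \<sigma> b"]
        by (simp add: comp_assoc)
      then show ?thesis by (simp only: C C_hat_seq_relabel[OF \<sigma>])
    qed
    have "x \<bullet> (C_hat_des n \<Sigma> (relabelled_design s) i j *v ones) = 0" for x
      unfolding C_hat_des_form by (simp add: eff_mat_ones bform_def)
    from this[of "C_hat_des n \<Sigma> (relabelled_design s) i j *v ones"]
    have "C_hat_des n \<Sigma> (relabelled_design s) i j *v ones = 0" by simp
    from permutation_invariant_matrix[OF card inv this] show ?thesis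
      by (simp add: trace_C_hat_des)
  qed
  with G show ?thesis by (simp add: balanced_def)
qed

lemma q_seq_relabel: "bij (\<pi> :: 't::finite \<Rightarrow> 't) \<Longrightarrow> q_seq \<Sigma> (\<pi> \<circ> s) x = q_seq \<Sigma> s x"
  by (simp add: q_seq_def c_seq_relabel)

lemma q_des_relabelled:
  fixes s :: "'p::{finite,linorder} \<Rightarrow> 't::finite"
  shows "q_des \<Sigma> (relabelled_design s) x = q_seq \<Sigma> s x"
proof -
  have "q_des \<Sigma> (relabelled_design s) x =
    (1 / real (card {\<pi> :: 't \<Rightarrow> 't. bij \<pi>})) * (\<Sum>\<pi> | bij (\<pi> :: 't \<Rightarrow> 't). q_seq \<Sigma> (\<pi> \<circ> s) x)"
    using relabelled_design_sum[of s "\<lambda>s. q_seq \<Sigma> s x"] by (simp add: q_des_def)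
  also have "(\<Sum>\<pi> | bij (\<pi> :: 't \<Rightarrow> 't). q_seq \<Sigma> (\<pi> \<circ> s) x) = (\<Sum>\<pi> | bij (\<pi> :: 't \<Rightarrow> 't). q_seq \<Sigma> s x)"
    by (intro sum.cong) (auto simp: q_seq_relabel)
  finally show ?thesis using bij_id by auto
qed

definition mix :: "real \<Rightarrow> ('p::finite, 't::finite) design \<Rightarrow> ('p, 't) design \<Rightarrow> ('p, 't) design" where
  "mix \<epsilon> P P' = (\<lambda>s. (1 - \<epsilon>) * P s + \<epsilon> * P' s)"

lemma approx_design_mix:
  assumes "approx_design P" "approx_design P'" "0 \<le> \<epsilon>" "\<epsilon> \<le> 1"
  shows "approx_design (mix \<epsilon> P P')"
  using assms by (simp add: approx_design_def mix_def sum.distrib flip: sum_distrib_left)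

lemma q_des_mix: "q_des \<Sigma> (mix \<epsilon> P P') x = (1 - \<epsilon>) * q_des \<Sigma> P x + \<epsilon> * q_des \<Sigma> P' x"
  by (simp add: q_des_def mix_def sum.distrib sum_subtractf sum_distrib_left algebra_simps)

lemma balanced_mix:
  fixes P :: "('p::{finite,linorder}, 't::finite) design"
  assumes P: "balanced n \<Sigma> P" and P': "balanced n \<Sigma> P'"
  shows "balanced n \<Sigma> (mix \<epsilon> P P')"
proof -
  have lin: "(\<Sum>s\<in>UNIV. mix \<epsilon> P P' s *\<^sub>R f s) =
      (1 - \<epsilon>) *\<^sub>R (\<Sum>s\<in>UNIV. P s *\<^sub>R f s) + \<epsilon> *\<^sub>R (\<Sum>s\<in>UNIV. P' s *\<^sub>R f s)"
    for f :: "_ \<Rightarrow> 'v::real_vector"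
    by (simp add: mix_def scaleR_add_left sum.distrib scaleR_sum_right)
  have "G_des (mix \<epsilon> P P') i = (1 - \<epsilon>) *\<^sub>R G_des P i + \<epsilon> *\<^sub>R G_des P' i" for i
    by (simp add: G_des_def lin)
  moreover have "C_hat_des n \<Sigma> (mix \<epsilon> P P') i j =
      (1 - \<epsilon>) *\<^sub>R C_hat_des n \<Sigma> P i j + \<epsilon> *\<^sub>R C_hat_des n \<Sigma> P' i j" for i j
    by (simp add: C_hat_des_def lin scaleR_add_right mult.commute)
  moreover have "c_des n \<Sigma> (mix \<epsilon> P P') i j =
      (1 - \<epsilon>) * c_des n \<Sigma> P i j + \<epsilon> * c_des n \<Sigma> P' i j" for i j
    by (simp add: c_des_def lin[of "\<lambda>s. c_seq \<Sigma> s i j", unfolded real_scaleR_def] distrib_left)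
  ultimately show ?thesis
    using P P' by (simp add: balanced_def add_divide_distrib scaleR_add_left)
qed

section \<open>The criterion and the parabolas\<close>

text \<open>The matrix \<open>A\<close> of expectations of the normalised outer product is
  permutation invariant by exchangeability, has zero row sums since the entries of \<tau> almost
  surely sum to 0, and has trace 1. Hence it is \<open>centering\<close> divided by t - 1.\<close>

lemma integral_exchangeable_normalized:
  fixes g :: "(real^'t::finite) measure" and H :: "real^'t^'t"
  assumes t: "2 \<le> CARD('t)" and g: "treatment_prior g" and ex: "exchangeable g"
    and H: "H *v ones = 0"
  shows "integrable g (\<lambda>\<tau>. \<tau> \<bullet> (H *v \<tau>) / (\<tau> \<bullet> \<tau>))" (is ?int)
    and "(LINT \<tau>|g. \<tau> \<bullet> (H *v \<tau>) / (\<tau> \<bullet> \<tau>)) = trace H / (real CARD('t) - 1)" (is ?eq)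
proof -
  interpret prob_space g using g by (simp add: treatment_prior_def)
  have sets [measurable_cong]: "sets g = sets borel"
    and ae: "AE \<tau> in g. (\<Sum>i\<in>UNIV. \<tau> $ i) = 0 \<and> \<tau> \<noteq> 0"
    using g by (auto simp: treatment_prior_def)
  have nth [measurable]: "(\<lambda>\<tau>. \<tau> $ i) \<in> borel_measurable borel" for i :: 't
    by (intro borel_measurable_continuous_onI continuous_intros)
  let ?f = "\<lambda>i j (\<tau> :: real^'t). \<tau> $ i * \<tau> $ j / (\<tau> \<bullet> \<tau>)"
  have f_meas [measurable]: "?f i j \<in> borel_measurable borel" for i j by measurable
  \<comment> \<open>Normalisation bounds the entries by 1, so no moments of the prior enter; at
    \<tau> = 0 the quotient is 0 by default.\<close>
  have int: "integrable g (?f i j)" for i j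
  proof (rule integrable_const_bound[where B = 1])
    have "\<bar>\<tau> $ i\<bar> * \<bar>\<tau> $ j\<bar> \<le> norm \<tau> * norm \<tau>" for \<tau> :: "real^'t"
      by (intro mult_mono component_le_norm_cart) auto
    then show "AE \<tau> in g. norm (?f i j \<tau>) \<le> 1"
      by (intro AE_I2) (auto simp: abs_mult divide_le_eq_1 dot_square_norm power2_eq_square)
  qed measurable
  define A where "A = (\<chi> i j. LINT \<tau>|g. ?f i j \<tau>)"
  have inv: "A $ \<pi> i $ \<pi> j = A $ i $ j" if \<pi>: "bij \<pi>" for \<pi> i j
  proof -
    let ?\<sigma> = "\<lambda>\<tau> :: real^'t. \<chi> i. \<tau> $ \<pi> i"
    have [measurable]: "?\<sigma> \<in> borel_measurable borel"
      by (intro borel_measurable_continuous_onI continuous_intros)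
    have "?\<sigma> \<tau> \<bullet> ?\<sigma> \<tau> = \<tau> \<bullet> \<tau>" for \<tau>
      using sum.reindex_bij_betw[OF \<pi>, of "\<lambda>i. \<tau> $ i * \<tau> $ i"] by (simp add: inner_vec_def)
    then have "A $ \<pi> i $ \<pi> j = (LINT \<tau>|g. ?f i j (?\<sigma> \<tau>))" by (simp add: A_def)
    also have "\<dots> = (LINT \<tau>|distr g borel ?\<sigma>. ?f i j \<tau>)"
      by (rule integral_distr[symmetric]) measurable
    also have "distr g borel ?\<sigma> = g" using ex \<pi> by (simp add: exchangeable_def)
    finally show ?thesis by (simp add: A_def)
  qed
  have "A *v ones = 0"
  proof (simp add: vec_eq_iff matrix_vector_mult_def, intro allI)
    fix i
    have "(\<Sum>j\<in>UNIV. A $ i $ j) = (LINT \<tau>|g. (\<Sum>j\<in>UNIV. ?f i j \<tau>))"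
      using int by (simp add: A_def)
    also have "\<dots> = (LINT \<tau>|g. 0)"
    proof (rule integral_cong_AE)
      show "AE \<tau> in g. (\<Sum>j\<in>UNIV. ?f i j \<tau>) = 0"
        using ae by eventually_elim (simp flip: sum_divide_distrib sum_distrib_left)
    qed measurable
    finally show "(\<Sum>j\<in>UNIV. A $ i $ j) = 0" by simp
  qed
  note A = permutation_invariant_matrix[OF t inv this]
  have "trace A = (LINT \<tau>|g. (\<Sum>i\<in>UNIV. ?f i i \<tau>))"
    using int by (simp add: trace_def A_def)
  also have "\<dots> = (LINT \<tau>|g. 1)"
  proof (rule integral_cong_AE)
    show "AE \<tau> in g. (\<Sum>i\<in>UNIV. ?f i i \<tau>) = 1"
      using ae by eventually_elim (simp add: inner_vec_def flip: sum_divide_distrib,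
          simp flip: inner_real_def inner_vec_def)
  qed measurable
  finally have trA: "trace A = 1" by (simp add: prob_space)
  have expand: "\<tau> \<bullet> (H *v \<tau>) / (\<tau> \<bullet> \<tau>) = (\<Sum>i\<in>UNIV. \<Sum>j\<in>UNIV. H $ i $ j * ?f i j \<tau>)" for \<tau>
    unfolding inner_vec_def[of \<tau> "H *v \<tau>"]
    by (simp add: matrix_vector_mult_def sum_distrib_left sum_divide_distrib mult_ac)
  show ?int unfolding expand
    by (intro Bochner_Integration.integrable_sum integrable_mult_right int)
  have row: "(\<Sum>j\<in>UNIV. H $ i $ j) = 0" for i
    using H by (simp add: vec_eq_iff matrix_vector_mult_def)
  have "(LINT \<tau>|g. \<tau> \<bullet> (H *v \<tau>) / (\<tau> \<bullet> \<tau>)) = (\<Sum>i\<in>UNIV. \<Sum>j\<in>UNIV. H $ i $ j * A $ i $ j)"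
    unfolding expand using int by (simp add: A_def del: times_divide_eq_right)
  \<comment> \<open>The constant part of \<open>centering\<close> only meets row sums of
    \<open>H\<close>, which vanish.\<close>
  also have "\<dots> = (\<Sum>i\<in>UNIV. \<Sum>j\<in>UNIV. (if i = j then H $ i $ j else 0) / (real CARD('t) - 1)
      - H $ i $ j / (real CARD('t) * (real CARD('t) - 1)))"
    by (subst A) (auto simp: trA centering_entry diff_divide_distrib algebra_simps intro!: sum.cong)
  also have "\<dots> = trace H / (real CARD('t) - 1)"
    by (simp add: sum_subtractf row trace_def flip: sum_divide_distrib)
  finally show ?eq .
qed

section \<open>Positivity and vertices of the parabolas\<close>

lemma c_seq_eq:
  "c_seq \<Sigma> s i j = (\<Sum>a\<in>UNIV. bform \<Sigma> (eff_mat i s *v axis a 1) (eff_mat j s *v axis a 1))"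
  by (simp add: c_seq_def trace_def C_hat_seq_entry)

text \<open>The parabola is a trace: it sums \<open>bform\<close> squares over the columns of the
  centered matrix T + x F.\<close>

lemma q_seq_eq:
  fixes s :: "'p::{finite,linorder} \<Rightarrow> 't::finite"
  assumes spd: "sym_pos_def \<Sigma>"
  shows "q_seq \<Sigma> s x = (\<Sum>a\<in>UNIV.
    bform \<Sigma> ((eff_mat Direct s + x *\<^sub>R eff_mat Carryover s) *v axis a 1)
      ((eff_mat Direct s + x *\<^sub>R eff_mat Carryover s) *v axis a 1))"
  by (simp add: q_seq_def c_seq_eq matrix_vector_mult_add_rdistrib bform_linear sum.distrib
      bform_commute[OF spd, of "eff_mat Carryover s *v _" "eff_mat Direct s *v _"]
      sum_distrib_left sum_distrib_right power2_eq_square algebra_simps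
      flip: scaleR_matrix_vector_assoc)

lemma q_des_nonneg:
  assumes "sym_pos_def \<Sigma>" "approx_design P"
  shows "0 \<le> q_des \<Sigma> P x"
  using assms by (auto simp: q_des_def q_seq_eq approx_design_def
      intro!: sum_nonneg mult_nonneg_nonneg bform_nonneg)

lemma two_periods:
  assumes "2 \<le> CARD('p)"
  obtains k0 k1 l :: "'p::{finite,linorder}" where "source Carryover k0 = None" "source Carryover k1 = Some l"
proof -
  define k0 :: 'p where "k0 = Min UNIV"
  have "\<exists>k1. k1 \<noteq> k0"
  proof (rule ccontr)
    assume "\<nexists>k1. k1 \<noteq> k0"
    then have "(UNIV :: 'p set) = {k0}" by auto
    then have "CARD('p) = card {k0}" by simp
    then show False using assms by simp
  qed
  then obtain k1 where "k1 \<noteq> k0" by blast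
  moreover have le: "k0 \<le> k" for k by (simp add: k0_def)
  ultimately have "k0 \<in> {..<k1}" by (simp add: order_less_le)
  then have "source Carryover k1 = Some (Max {..<k1})" by auto
  moreover have "source Carryover k0 = None" using le by (auto simp: not_less[symmetric])
  ultimately show thesis using that by blast
qed

lemma two_elements:
  assumes "2 \<le> CARD('t)"
  obtains b where "b \<noteq> (a :: 't::finite)"
proof (rule ccontr)
  assume "\<not> thesis"
  then have "(UNIV :: 't set) = {a}" using that by auto
  then have "CARD('t) = card {a}" by simp
  then show False using assms by simp
qed

text \<open>The column of treatment \<open>s l\<close> in the carryover matrix has 0 in the first
  period \<open>k0\<close> and 1 - 1/t in period \<open>k1\<close>, so it is not constant.\<close>

lemma c_seq_Carryover_pos:
  fixes s :: "'p::{finite,linorder} \<Rightarrow> 't::finite"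
  assumes spd: "sym_pos_def \<Sigma>" and p: "2 \<le> CARD('p)" and t: "2 \<le> CARD('t)"
  shows "0 < c_seq \<Sigma> s Carryover Carryover"
proof -
  obtain k0 k1 l :: 'p where k: "source Carryover k0 = None" "source Carryover k1 = Some l"
    by (rule two_periods[OF p])
  have "(eff_mat Carryover s *v axis (s l) 1) $ k0 \<noteq> (eff_mat Carryover s *v axis (s l) 1) $ k1"
    using t k by (simp add: eff_mat_axis eff_mat_entry centering_entry del: source.simps)
  then show ?thesis
    unfolding c_seq_eq using bform_nonneg[OF spd]
    by (intro sum_pos2[of UNIV "s l"] bform_pos[OF spd]) auto
qed

lemma c_des_Carryover_pos:
  fixes P :: "('p::{finite,linorder}, 't::finite) design"
  assumes spd: "sym_pos_def \<Sigma>" and p: "2 \<le> CARD('p)" and t: "2 \<le> CARD('t)"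
    and P: "approx_design P" and n: "1 \<le> n"
  shows "0 < c_des n \<Sigma> P Carryover Carryover"
proof -
  have "\<exists>s. P s \<noteq> 0"
    using P by (auto simp: approx_design_def) (metis sum.neutral zero_neq_one)
  then obtain s where "0 < P s" using P by (auto simp: approx_design_def order_less_le)
  then have "0 < (\<Sum>s\<in>UNIV. P s * c_seq \<Sigma> s Carryover Carryover)"
    using P c_seq_Carryover_pos[OF spd p t]
    by (intro sum_pos2[of UNIV s]) (auto simp: approx_design_def less_imp_le)
  then show ?thesis using n by (simp add: c_des_def)
qed

text \<open>Later gives positivity of the optimal parabola, which dominates all \<open>q_seq\<close>
  at its vertex.\<close>

lemma ex_q_seq_pos:
  fixes \<Sigma> :: "('p::{finite,linorder}) sqmat"
  assumes spd: "sym_pos_def \<Sigma>" and p: "2 \<le> CARD('p)" and t: "2 \<le> CARD('t)"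
  obtains s :: "'p \<Rightarrow> 't::finite" where "0 < q_seq \<Sigma> s x"
proof -
  obtain k0 k1 l :: 'p where k: "source Carryover k0 = None" "source Carryover k1 = Some l"
    by (rule two_periods[OF p])
  then have "k0 \<noteq> k1" by auto
  define a :: 't where "a = undefined"
  obtain b where b: "b \<noteq> a" by (rule two_elements[OF t])
  \<comment> \<open>For \<open>x\<close> nonzero the missing carryover of the first period already
    makes the column of a constant sequence nonconstant. For \<open>x = 0\<close> the treatment has
    to change.\<close>
  define s where "s = (\<lambda>k. if x = 0 \<and> k = k1 then b else a)"
  define y where "y = (eff_mat Direct s + x *\<^sub>R eff_mat Carryover s) *v axis a 1"
  have y: "y $ k = eff_mat Direct s $ k $ a + x * eff_mat Carryover s $ k $ a" for k
    by (simp add: y_def matrix_vector_mult_basis column_def)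
  have "y $ k0 \<noteq> y $ k1"
  proof (cases "x = 0")
    case True
    then show ?thesis using b \<open>k0 \<noteq> k1\<close>
      unfolding y by (simp add: eff_mat_entry centering_entry s_def)
  next
    case False
    then have "y $ k1 - y $ k0 = x * (1 - 1 / real CARD('t))"
      using k unfolding y by (simp add: eff_mat_entry centering_entry s_def del: source.simps(2))
    then show ?thesis using False t by auto
  qed
  then have "0 < q_seq \<Sigma> s x"
    unfolding q_seq_eq[OF spd] using bform_nonneg[OF spd]
    by (intro sum_pos2[of UNIV a]) (auto simp: y_def intro: bform_pos[OF spd])
  then show thesis by (rule that)
qed

lemma q_des_eq:
  assumes "1 \<le> n"
  shows "real n * q_des \<Sigma> P x = c_des n \<Sigma> P Direct Direct + 2 * c_des n \<Sigma> P Direct Carryover * x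
    + c_des n \<Sigma> P Carryover Carryover * x\<^sup>2"
  by (simp add: q_des_def q_seq_def c_des_def sum.distrib sum_distrib_left sum_distrib_right
      algebra_simps)

text \<open>Completing the square; the positive leading coefficient makes \<open>x_des\<close> the
  unique minimiser, and the minimum is a Schur complement.\<close>

lemma q_des_vertex:
  assumes n: "1 \<le> n" and c: "0 < c_des n \<Sigma> P Carryover Carryover"
  shows "real n * q_des \<Sigma> P x = real n * q_des \<Sigma> P (x_des n \<Sigma> P)
    + c_des n \<Sigma> P Carryover Carryover * (x - x_des n \<Sigma> P)\<^sup>2"
    and "real n * q_des \<Sigma> P (x_des n \<Sigma> P) = c_des n \<Sigma> P Direct Direct
      - (c_des n \<Sigma> P Direct Carryover)\<^sup>2 / c_des n \<Sigma> P Carryover Carryover"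
  using c by (simp_all add: q_des_eq[OF n] x_des_def field_simps power2_eq_square)

section \<open>Upper bound and exact value of the criterion\<close>

text \<open>The eigenvalue is at most the Rayleigh quotient at \<tau>, then the joint form at
  \<open>x \<tau>\<close>, then the form of \<open>H\<close>, whose prior average is its trace over
  t - 1. The parameter \<open>x\<close> is free, so the vertex of another design may be
  inserted.\<close>

lemma E_crit_le:
  fixes P :: "('p::{finite,linorder}, 't::finite) design"
  assumes t: "2 \<le> CARD('t)" and spd: "sym_pos_def \<Sigma>"
    and g: "treatment_prior g" and ex: "exchangeable g" and P: "approx_design P"
  shows "E_crit g lam n \<Sigma> P \<le> real n * q_des \<Sigma> P x / (real CARD('t) - 1)"
proof -
  interpret prob_space g using g by (simp add: treatment_prior_def)
  define Y where "Y s = eff_mat Direct s + x *\<^sub>R eff_mat Carryover s" for s :: "'p \<Rightarrow> 't"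
  define H where "H = real n *\<^sub>R (\<Sum>s\<in>UNIV. P s *\<^sub>R (transpose (Y s) ** B_tilde \<Sigma> ** Y s))"
  have H: "u \<bullet> (H *v v) = real n * (\<Sum>s\<in>UNIV. P s * bform \<Sigma> (Y s *v u) (Y s *v v))" for u v
    by (simp add: H_def matrix_sum_scaleR_mult inner_sum_right bform_def inner_transpose_vector
        del: transpose_matrix_vector flip: scaleR_matrix_vector_assoc matrix_vector_mul_assoc)
  have "u \<bullet> (H *v ones) = 0" for u
    unfolding H by (simp add: Y_def matrix_vector_mult_add_rdistrib eff_mat_ones bform_def
        flip: scaleR_matrix_vector_assoc)
  from this[of "H *v ones"] have H1: "H *v ones = 0" by simp
  have "trace H = real n * (\<Sum>a\<in>UNIV. \<Sum>s\<in>UNIV. P s * bform \<Sigma> (Y s *v axis a 1) (Y s *v axis a 1))"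
    by (simp add: trace_def matrix_entry_inner H sum_distrib_left)
  also have "\<dots> = real n * q_des \<Sigma> P x"
    by (subst sum.swap) (simp add: q_des_def q_seq_eq[OF spd] Y_def sum_distrib_left)
  finally have trH: "trace H = real n * q_des \<Sigma> P x" .
  have pw: "second_smallest_eigenvalue (info_mat n \<Sigma> P \<tau> lam) \<le> \<tau> \<bullet> (H *v \<tau>) / (\<tau> \<bullet> \<tau>)"
    if \<tau>: "(\<Sum>i\<in>UNIV. \<tau> $ i) = 0 \<and> \<tau> \<noteq> 0" for \<tau>
  proof -
    have "\<tau> \<bullet> ones = 0" using \<tau> by (simp add: inner_vec_def)
    then have "second_smallest_eigenvalue (info_mat n \<Sigma> P \<tau> lam) * (\<tau> \<bullet> \<tau>)
        \<le> \<tau> \<bullet> (info_mat n \<Sigma> P \<tau> lam *v \<tau>)"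
      by (intro second_smallest_eigenvalue_le[where u = ones] transpose_info_mat info_mat_ones
          info_mat_nonneg spd P) (simp_all add: vec_eq_iff)
    also have "\<dots> \<le> joint_form \<Sigma> n P \<tau> (x *\<^sub>R \<tau>)"
      by (rule info_mat_le_joint_form[OF spd P])
    also have "\<dots> \<le> \<tau> \<bullet> (H *v \<tau>)"
      unfolding H using joint_form_le[OF spd, of n P \<tau> "x *\<^sub>R \<tau>"]
      by (simp add: Y_def matrix_vector_mult_add_rdistrib matrix_vector_mult_scaleR
          flip: scaleR_matrix_vector_assoc)
    finally show ?thesis using \<tau> by (simp add: pos_le_divide_eq)
  qed
  show ?thesis
  proof (cases "integrable g (\<lambda>\<tau>. second_smallest_eigenvalue (info_mat n \<Sigma> P \<tau> lam))")
    case True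
    have "E_crit g lam n \<Sigma> P \<le> (LINT \<tau>|g. \<tau> \<bullet> (H *v \<tau>) / (\<tau> \<bullet> \<tau>))"
      unfolding E_crit_def
    proof (rule integral_mono_AE[OF True integral_exchangeable_normalized(1)[OF t g ex H1]])
      show "AE \<tau> in g. second_smallest_eigenvalue (info_mat n \<Sigma> P \<tau> lam) \<le> \<tau> \<bullet> (H *v \<tau>) / (\<tau> \<bullet> \<tau>)"
        using g pw unfolding treatment_prior_def by (auto elim: eventually_mono)
    qed
    then show ?thesis
      by (simp add: integral_exchangeable_normalized(2)[OF t g ex H1] trH)
  next
    case False \<comment> \<open>the Bochner integral is then 0 by default, so no measurability is needed for the bound\<close>
    then show ?thesis
      using t q_des_nonneg[OF spd P, of x] by (simp add: E_crit_def not_integrable_integral_eq)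
  qed
qed

text \<open>
  For a balanced design the information matrix depends on \<open>\<tau>\<close> only through the line spanned by
  \<open>centering *v \<tau>\<close>, and its second smallest eigenvalue not even on that line. The value changes
  only on the closed null set where \<open>centering *v \<tau> = 0\<close>, so the integrand is Borel.
\<close>

lemma E_crit_balanced:
  fixes P :: "('p::{finite,linorder}, 't::finite) design"
  assumes p: "2 \<le> CARD('p)" and t: "2 \<le> CARD('t)" and n: "1 \<le> n" and spd: "sym_pos_def \<Sigma>"
    and g: "treatment_prior g" and P: "approx_design P" and bal: "balanced n \<Sigma> P"
  shows "E_crit g lam n \<Sigma> P = real n * q_des \<Sigma> P (x_des n \<Sigma> P) / (real CARD('t) - 1)"
proof -
  interpret prob_space g using g by (simp add: treatment_prior_def)
  have sets [measurable_cong]: "sets g = sets borel"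
    and ae: "AE \<tau> in g. (\<Sum>i\<in>UNIV. \<tau> $ i) = 0 \<and> \<tau> \<noteq> 0"
    using g by (auto simp: treatment_prior_def)
  define a where "a i j = c_des n \<Sigma> P i j / (real CARD('t) - 1)" for i j
  let ?d = "a Direct Direct" and ?m = "a Direct Carryover" and ?c = "a Carryover Carryover"
  define \<alpha> where "\<alpha> = ?d + 2 * lam * ?m + lam\<^sup>2 * ?c"
  define \<beta> where "\<beta> = real n * q_des \<Sigma> P (x_des n \<Sigma> P) / (real CARD('t) - 1)"
  have c: "0 < ?c" using c_des_Carryover_pos[OF spd p t P n] t by (simp add: a_def)
  have scale: "(d - m\<^sup>2 / c) / r = d / r - (m / r)\<^sup>2 / (c / r)" if "c \<noteq> 0" "r \<noteq> 0"
    for d m c r :: real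
    using that by (simp add: field_simps power2_eq_square)
  have \<beta>: "\<beta> = ?d - ?m\<^sup>2 / ?c"
    unfolding \<beta>_def q_des_vertex(2)[OF n c_des_Carryover_pos[OF spd p t P n]] a_def
    using t c_des_Carryover_pos[OF spd p t P n] by (intro scale) auto
  \<comment> \<open>The dependence on \<open>lam\<close> cancels in the Schur complement.\<close>
  have \<alpha>\<beta>: "\<alpha> - (?m + lam * ?c)\<^sup>2 / ?c = \<beta>"
    using c unfolding \<alpha>_def \<beta> by (simp add: field_simps power2_eq_square)
  \<comment> \<open>Balance turns all four forms into multiples of one inner product of centered
    vectors.\<close>
  have C: "u \<bullet> (C_des n \<Sigma> P i j *v v) = a i j * ((centering *v u) \<bullet> (centering *v v))" for i j u v
    using inner_centering[of u v]
    by (simp add: balanced_C_des[OF bal] a_def flip: scaleR_matrix_vector_assoc)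
  have form: "v \<bullet> (info_mat n \<Sigma> P \<tau> lam *v v) = \<alpha> * (v \<bullet> v) -
      ((?m + lam * ?c) * (v \<bullet> (centering *v \<tau>)))\<^sup>2 / (?c * ((centering *v \<tau>) \<bullet> (centering *v \<tau>)))"
    if "v \<bullet> ones = 0" for v \<tau>
    using that unfolding info_mat_form[OF spd] C \<alpha>_def
    by (simp add: centering_ident inner_commute algebra_simps power2_eq_square)
  obtain b :: 't where b: "b \<noteq> undefined" by (rule two_elements[OF t])
  define z :: "real^'t" where "z = axis undefined 1 - axis b 1"
  have z: "z \<bullet> ones = 0" "z \<noteq> 0"
  proof -
    show "z \<bullet> ones = 0" by (simp add: z_def inner_diff_left inner_axis')
    have "z $ b \<noteq> 0" using b by (simp add: z_def axis_def)
    then show "z \<noteq> 0" by auto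
  qed
  have ones: "(ones :: real^'t) \<noteq> 0" by (simp add: vec_eq_iff)
  have val: "second_smallest_eigenvalue (info_mat n \<Sigma> P \<tau> lam) =
      (if centering *v \<tau> = 0 then \<alpha> else \<beta>)" for \<tau>
  proof (cases "centering *v \<tau> = 0")
    case True
    \<comment> \<open>Here the correction vanishes and the form is \<alpha> times the squared norm
      on the complement of \<open>ones\<close>.\<close>
    then show ?thesis
      using z by (auto intro!: second_smallest_eigenvalue_eqI[OF transpose_info_mat[OF spd]
            info_mat_ones[OF spd] ones info_mat_nonneg[OF spd P]] simp: form)
  next
    case False
    define w where "w = centering *v \<tau>"
    have w: "w \<bullet> ones = 0" "w \<noteq> 0"
      using False ones_inner_centering[of \<tau>] by (simp_all add: w_def inner_commute)
    have form': "v \<bullet> (info_mat n \<Sigma> P \<tau> lam *v v) =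
        \<alpha> * (v \<bullet> v) - (?m + lam * ?c)\<^sup>2 / ?c * ((v \<bullet> w)\<^sup>2 / (w \<bullet> w))" if "v \<bullet> ones = 0" for v
      unfolding form[OF that] w_def by (simp add: power_mult_distrib)
    have "second_smallest_eigenvalue (info_mat n \<Sigma> P \<tau> lam) = \<beta>"
    proof (rule second_smallest_eigenvalue_eqI[OF transpose_info_mat[OF spd]
            info_mat_ones[OF spd] ones info_mat_nonneg[OF spd P] w])
      show "w \<bullet> (info_mat n \<Sigma> P \<tau> lam *v w) = \<beta> * (w \<bullet> w)"
        unfolding form'[OF w(1)] \<alpha>\<beta>[symmetric] using w(2)
        by (simp add: power2_eq_square left_diff_distrib)
    next
      fix v :: "real^'t"
      assume v: "v \<bullet> ones = 0"
      \<comment> \<open>By Cauchy-Schwarz the correction per squared norm is largest along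
        \<open>w\<close>, where \<beta> is attained.\<close>
      have "(v \<bullet> w)\<^sup>2 / (w \<bullet> w) \<le> v \<bullet> v"
        using Cauchy_Schwarz_ineq[of v w] w(2) by (simp add: divide_le_eq)
      then have "(?m + lam * ?c)\<^sup>2 / ?c * ((v \<bullet> w)\<^sup>2 / (w \<bullet> w)) \<le> (?m + lam * ?c)\<^sup>2 / ?c * (v \<bullet> v)"
        using c by (intro mult_left_mono) auto
      then show "\<beta> * (v \<bullet> v) \<le> v \<bullet> (info_mat n \<Sigma> P \<tau> lam *v v)"
        unfolding form'[OF v] \<alpha>\<beta>[symmetric] by (simp add: left_diff_distrib)
    qed
    then show ?thesis using False by simp
  qed
  have "closed {\<tau> :: real^'t. centering *v \<tau> = 0}"
    by (intro closed_Collect_eq continuous_intros linear_continuous_on matrix_vector_mul_bounded_linear)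
  then have [measurable]: "Measurable.pred borel (\<lambda>\<tau> :: real^'t. centering *v \<tau> = 0)"
    by (simp add: pred_def)
  have "E_crit g lam n \<Sigma> P = (LINT \<tau>|g. \<beta>)"
    unfolding E_crit_def val
  proof (rule integral_cong_AE)
    show "AE \<tau> in g. (if centering *v \<tau> = 0 then \<alpha> else \<beta>) = \<beta>"
      using ae by eventually_elim (auto simp: centering_ident inner_vec_def)
  qed measurable
  then show ?thesis by (simp add: prob_space \<beta>_def)
qed

section \<open>Necessity of the condition\<close>

text \<open>A violating \<open>s\<close> would give a balanced mixture whose whole parabola lies
  above the minimum of that of \<open>P\<close>. The exact value of the criterion for balanced
  designs then contradicts optimality.\<close>

lemma optimal_q_seq_le:
  fixes P :: "('p::{finite,linorder}, 't::finite) design" and s :: "'p \<Rightarrow> 't"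
  assumes p: "2 \<le> CARD('p)" and t: "2 \<le> CARD('t)" and n: "1 \<le> n" and spd: "sym_pos_def \<Sigma>"
    and g: "treatment_prior g" and bal: "balanced n \<Sigma> P"
    and opt: "E_optimal g lam n \<Sigma> P"
  shows "q_seq \<Sigma> s (x_des n \<Sigma> P) \<le> q_des \<Sigma> P (x_des n \<Sigma> P)"
proof (rule ccontr)
  let ?x = "x_des n \<Sigma> P"
  let ?S = "relabelled_design s"
  assume "\<not> ?thesis"
  then have d: "0 < q_seq \<Sigma> s ?x - q_des \<Sigma> P ?x" by simp
  have P: "approx_design P" using opt by (simp add: E_optimal_def)
  note c = c_des_Carryover_pos[OF spd p t P n]
  define cs where "cs i j = c_seq \<Sigma> s i j" for i j
  have a: "0 < c_des n \<Sigma> P Carryover Carryover / real n" using c n by simp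
  \<comment> \<open>Both parabolas are expanded at \<open>?x\<close>: the linear coefficient is the
    derivative of \<open>q_seq\<close> there, and dividing by \<open>n\<close> undoes the scaling in
    \<open>c_des\<close>.\<close>
  obtain \<epsilon> where \<epsilon>: "0 < \<epsilon>" "\<epsilon> \<le> 1"
    and pert: "\<And>y. cs Carryover Carryover \<ge> 0 \<Longrightarrow>
      0 < (1 - \<epsilon>) * (c_des n \<Sigma> P Carryover Carryover / real n * y\<^sup>2) + \<epsilon> *
        ((q_seq \<Sigma> s ?x - q_des \<Sigma> P ?x) + (2 * cs Direct Carryover + 2 * cs Carryover Carryover * ?x) * y
          + cs Carryover Carryover * y\<^sup>2)"
    using quadratic_perturbation[OF a d] by metis
  let ?M = "mix \<epsilon> P ?S"
  have M: "approx_design ?M" "balanced n \<Sigma> ?M"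
    using \<epsilon> by (simp_all add: approx_design_mix balanced_mix P bal approx_design_relabelled balanced_relabelled[OF t])
  have gt: "q_des \<Sigma> P ?x < q_des \<Sigma> ?M x" for x
  proof -
    have q1: "q_des \<Sigma> P x = q_des \<Sigma> P ?x + c_des n \<Sigma> P Carryover Carryover / real n * (x - ?x)\<^sup>2"
      using q_des_vertex(1)[OF n c, of x] n by (simp add: field_simps)
    have q2: "q_seq \<Sigma> s x = q_seq \<Sigma> s ?x + (2 * cs Direct Carryover + 2 * cs Carryover Carryover * ?x) * (x - ?x)
          + cs Carryover Carryover * (x - ?x)\<^sup>2"
      by (simp add: q_seq_def cs_def power2_eq_square algebra_simps)
    have "cs Carryover Carryover \<ge> 0"
      using c_seq_Carryover_pos[OF spd p t, of s] by (simp add: cs_def)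
    from pert[OF this, of "x - ?x"] show ?thesis
      unfolding q_des_mix q_des_relabelled q1 q2 by (simp add: algebra_simps)
  qed
  \<comment> \<open>\<open>gt\<close> is used at the vertex of the mixture.\<close>
  have "E_crit g lam n \<Sigma> P < E_crit g lam n \<Sigma> ?M"
    unfolding E_crit_balanced[OF p t n spd g P bal] E_crit_balanced[OF p t n spd g M]
    using t n gt by (intro divide_strict_right_mono mult_strict_left_mono) auto
  then show False using opt M(1) unfolding E_optimal_def by (meson not_le)
qed

theorem theorem8:
  fixes n :: nat
    and \<Sigma> :: "('p::{finite,linorder}) sqmat"
    and lam :: real
    and g :: "(real^'t::finite) measure"
    and P :: "('p, 't) design"
  assumes "CARD('p) \<ge> 2" and "CARD('t) \<ge> 2" and "n \<ge> 1"
    and "sym_pos_def \<Sigma>"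
    and "treatment_prior g" and "exchangeable g"
    and "approx_design P" and "pseudo_symmetric n \<Sigma> P"
  shows "(E_optimal g lam n \<Sigma> P \<longleftrightarrow>
           q_des \<Sigma> P (x_des n \<Sigma> P) > 0 \<and>
           Max (range (\<lambda>s :: 'p \<Rightarrow> 't. q_seq \<Sigma> s (x_des n \<Sigma> P) / q_des \<Sigma> P (x_des n \<Sigma> P))) = 1) \<and>
         (E_optimal g lam n \<Sigma> P \<longrightarrow>
           (\<forall>s. P s > 0 \<longrightarrow>
             q_seq \<Sigma> s (x_des n \<Sigma> P) / q_des \<Sigma> P (x_des n \<Sigma> P) =
             Max (range (\<lambda>s' :: 'p \<Rightarrow> 't. q_seq \<Sigma> s' (x_des n \<Sigma> P) / q_des \<Sigma> P (x_des n \<Sigma> P)))))"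
proof -
  note p = assms(1) and t = assms(2) and n = assms(3) and spd = assms(4) and g = assms(5)
    and ex = assms(6) and P = assms(7)
  have bal: "balanced n \<Sigma> P" by (rule pseudo_symmetric_balanced[OF t assms(8)])
  let ?x = "x_des n \<Sigma> P"
  let ?q = "q_des \<Sigma> P ?x"
  let ?R = "range (\<lambda>s :: 'p \<Rightarrow> 't. q_seq \<Sigma> s ?x / ?q)"
  have P0: "0 \<le> P s" and P1: "(\<Sum>s\<in>UNIV. P s) = 1" for s
    using P by (auto simp: approx_design_def)
  have opt: "0 < ?q \<and> (\<forall>s. P s > 0 \<longrightarrow> q_seq \<Sigma> s ?x = ?q) \<and> Max ?R = 1"
    if "E_optimal g lam n \<Sigma> P"
  proof -
    have le: "q_seq \<Sigma> s ?x \<le> ?q" for s :: "'p \<Rightarrow> 't"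
      by (rule optimal_q_seq_le[OF p t n spd g bal that])
    obtain s0 :: "'p \<Rightarrow> 't" where "0 < q_seq \<Sigma> s0 ?x" by (rule ex_q_seq_pos[OF spd p t])
    then have pos: "0 < ?q" using le[of s0] by simp
    \<comment> \<open>The nonnegative gaps average to 0 under \<open>P\<close>, hence vanish on its
      support.\<close>
    have "(\<Sum>s\<in>UNIV. P s * (?q - q_seq \<Sigma> s ?x)) = ?q - (\<Sum>s\<in>UNIV. P s * q_seq \<Sigma> s ?x)"
      using P1 by (simp add: right_diff_distrib sum_subtractf flip: sum_distrib_right)
    then have "(\<Sum>s\<in>UNIV. P s * (?q - q_seq \<Sigma> s ?x)) = 0" by (simp add: q_des_def)
    then have "P s * (?q - q_seq \<Sigma> s ?x) = 0" for s
      using P0 le by (subst (asm) sum_nonneg_eq_0_iff) auto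
    then have eq: "q_seq \<Sigma> s ?x = ?q" if "P s > 0" for s using that by (metis eq_iff_diff_eq_0 less_irrefl mult_eq_0_iff)
    have "\<exists>s. P s \<noteq> 0" using P1 by (metis sum.neutral zero_neq_one)
    then obtain s where "P s > 0" using P0 by (auto simp: order_less_le)
    then have "q_seq \<Sigma> s ?x / ?q = 1" using eq pos by simp
    then have "1 \<in> ?R" by (metis rangeI)
    then have "Max ?R = 1"
      using pos le by (intro Max_eqI) (auto simp: divide_le_eq_1)
    with pos eq show ?thesis by blast
  qed
  have "E_optimal g lam n \<Sigma> P" if pos: "0 < ?q" and max: "Max ?R = 1"
    unfolding E_optimal_def
  proof (intro conjI allI impI P)
    fix P' :: "('p, 't) design"
    assume P': "approx_design P'"
    have "q_seq \<Sigma> s ?x \<le> ?q" for s :: "'p \<Rightarrow> 't"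
    proof -
      have "q_seq \<Sigma> s ?x / ?q \<le> Max ?R" by (intro Max_ge) auto
      then show ?thesis using pos by (simp add: max)
    qed
    then have "q_des \<Sigma> P' ?x \<le> (\<Sum>s\<in>UNIV. P' s * ?q)"
      using P' unfolding q_des_def[of _ P'] by (intro sum_mono mult_left_mono) (auto simp: approx_design_def)
    also have "\<dots> = ?q" using P' by (simp add: approx_design_def flip: sum_distrib_right)
    finally have "real n * q_des \<Sigma> P' ?x / (real CARD('t) - 1) \<le> real n * ?q / (real CARD('t) - 1)"
      using t by (intro divide_right_mono mult_left_mono) auto
    \<comment> \<open>The bound for \<open>P'\<close> is taken at the vertex of \<open>P\<close>,
      where the maximum condition controls every \<open>q_seq\<close>.\<close>
    with E_crit_le[OF t spd g ex P', of lam n ?x]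
    show "E_crit g lam n \<Sigma> P' \<le> E_crit g lam n \<Sigma> P"
      unfolding E_crit_balanced[OF p t n spd g P bal] by (rule order_trans)
  qed
  with opt show ?thesis by auto
qed

end
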